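(* Let $\Lambda$ be a finite-dimensional basic algebra over a field $k$ with Jacobson radical $J$ satisfying $J^n=0$. Let $e_i,e_j$ be primitive idempotents, and set $P_i=\Lambda e_i$, $D_h=e_h\Lambda e_h/e_hJe_h$, $V_{ij}=e_jJ^{n-1}e_i$. Assume $V_{ij}\neq 0$, and write $\ell_{ij}=\dim_{D_j}V_{ij}$. Then, for every $1\le s\le \ell_{ij}$, there is a natural bijection $$\mathcal F^{<n,\mathrm{top},s}_{ij}\;\cong\;\operatorname{Gr}_{D_j}(\ell_{ij}-s,V_{ij})/D_i^\times,$$ where $D_i^\times$ acts by right multiplication. More precisely, if $U,U'\in \operatorname{Gr}_{D_j}(\ell_{ij}-s,V_{ij})$, then $M_U\cong M_{U'}$ as $\Lambda$-modules if and only if $U'=Ua$ for some $a\in D_i^\times$.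
   Context: Modules are finite-dimensional left $\Lambda$-modules, $n\ge 1$, and $J^0=\Lambda$. Fix a complete set $e_1,\dots,e_t$ of primitive orthogonal idempotents of $\Lambda$, with $e_i,e_j$ among them; $\Lambda$ basic means the modules $\Lambda e_h$ are pairwise non-isomorphic. Each $D_h=e_h\Lambda e_h/e_hJe_h$ is a division algebra, and $V_{ij}=e_jJ^{n-1}e_i$ is a $(D_j,D_i)$-bimodule via left and right multiplication (well defined since $JJ^{n-1}=J^{n-1}J=0$). $\operatorname{Gr}_{D_j}(\ell_{ij}-s,V_{ij})$ is the set of left $D_j$-submodules $U\subseteq V_{ij}$ with $\dim_{D_j}(V_{ij}/U)=s$. Put $W_j=\bigoplus_{h\ne j}e_hJ^{n-1}P_i$, and for such $U$ put $K_U=W_j\oplus U\subseteq J^{n-1}P_i$ (a $\Lambda$-submodule of $P_i$) and $M_U=P_i/K_U$. The rank-$s$ terminal ambiguity fibre is $$\mathcal F^{<n,\mathrm{top},s}_{ij}=\{M_U: U\in\operatorname{Gr}_{D_j}(\ell_{ij}-s,V_{ij})\}/\cong,$$ the set of isomorphism classes of the modules $M_U$. *)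

theory Defs
  imports "HOL-Algebra.Algebra"
begin

section \<open>Left modules over non-commutative rings\<close>

text \<open>
  The locale \<^locale>\<open>module\<close> of HOL-Algebra requires a commutative ring of scalars, so only its
  record type is reused here.  The fields for multiplication and one of that record carry no
  meaning for a module and are left unspecified.  The locale \<^locale>\<open>submodule\<close> makes no
  commutativity assumption and is used as it stands.
\<close>

definition mk_module ::
  "'b set \<Rightarrow> ('b \<Rightarrow> 'b \<Rightarrow> 'b) \<Rightarrow> 'b \<Rightarrow> ('r \<Rightarrow> 'b \<Rightarrow> 'b) \<Rightarrow> ('r, 'b) module"
  where "mk_module S a z s =
    \<lparr>carrier = S, monoid.mult = undefined, one = undefined, ring.zero = z, ring.add = a, smult = s\<rparr>"

definition quot_module ::
  "('r, 'b, 'm) module_scheme \<Rightarrow> 'b set \<Rightarrow> ('r, 'b set) module"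
  where "quot_module M N =
    mk_module (a_rcosets\<^bsub>M\<^esub> N) (set_add M) N (\<lambda>r C. (\<Union>x\<in>C. N +>\<^bsub>M\<^esub> (r \<odot>\<^bsub>M\<^esub> x)))"

definition module_iso ::
  "('r, 'c) ring_scheme \<Rightarrow> ('r, 'a, 'm) module_scheme \<Rightarrow> ('r, 'b, 'n) module_scheme \<Rightarrow> bool"
  where "module_iso R M N \<longleftrightarrow>
    (\<exists>f \<in> iso (add_monoid M) (add_monoid N).
       \<forall>r\<in>carrier R. \<forall>x\<in>carrier M. f (r \<odot>\<^bsub>M\<^esub> x) = r \<odot>\<^bsub>N\<^esub> f x)"

definition module_basis ::
  "('r, 'c) ring_scheme \<Rightarrow> ('r, 'b, 'm) module_scheme \<Rightarrow> 'b set \<Rightarrow> bool"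
  where "module_basis R M B \<longleftrightarrow> finite B \<and> B \<subseteq> carrier M \<and>
    (\<forall>x\<in>carrier M. \<exists>c \<in> B \<rightarrow> carrier R. x = (\<Oplus>\<^bsub>M\<^esub>b\<in>B. c b \<odot>\<^bsub>M\<^esub> b)) \<and>
    (\<forall>c \<in> B \<rightarrow> carrier R. (\<Oplus>\<^bsub>M\<^esub>b\<in>B. c b \<odot>\<^bsub>M\<^esub> b) = \<zero>\<^bsub>M\<^esub> \<longrightarrow> (\<forall>b\<in>B. c b = \<zero>\<^bsub>R\<^esub>))"

text \<open>Meaningful for finite-dimensional left vector spaces \<open>M\<close> over a division ring \<open>R\<close>.\<close>

definition module_dim :: "('r, 'c) ring_scheme \<Rightarrow> ('r, 'b, 'm) module_scheme \<Rightarrow> nat"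
  where "module_dim R M = (THE d. \<exists>B. module_basis R M B \<and> card B = d)"


section \<open>Finite-dimensional algebras\<close>

locale fin_dim_algebra = module K A + K: field K + A: ring A
  for K :: "('k, 'c) ring_scheme" and A :: "('k, 'a, 'm) module_scheme" +
  assumes smult_mult_left: "\<lbrakk>c \<in> carrier K; x \<in> carrier A; y \<in> carrier A\<rbrakk> \<Longrightarrow>
      (c \<odot>\<^bsub>A\<^esub> x) \<otimes>\<^bsub>A\<^esub> y = c \<odot>\<^bsub>A\<^esub> (x \<otimes>\<^bsub>A\<^esub> y)"
    and smult_mult_right: "\<lbrakk>c \<in> carrier K; x \<in> carrier A; y \<in> carrier A\<rbrakk> \<Longrightarrow>
      x \<otimes>\<^bsub>A\<^esub> (c \<odot>\<^bsub>A\<^esub> y) = c \<odot>\<^bsub>A\<^esub> (x \<otimes>\<^bsub>A\<^esub> y)"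
    and finite_dimensional: "\<exists>B. module_basis K A B"

definition left_ideal_module :: "('a, 'm) ring_scheme \<Rightarrow> 'a set \<Rightarrow> ('a, 'a) module"
  where "left_ideal_module A I = mk_module I (add A) \<zero>\<^bsub>A\<^esub> (monoid.mult A)"

abbreviation left_ideal :: "'a set \<Rightarrow> ('a, 'm) ring_scheme \<Rightarrow> bool"
  where "left_ideal I A \<equiv> submodule I A (left_ideal_module A (carrier A))"

definition maximal_left_ideal :: "'a set \<Rightarrow> ('a, 'm) ring_scheme \<Rightarrow> bool"
  where "maximal_left_ideal I A \<longleftrightarrow> left_ideal I A \<and> I \<noteq> carrier A \<and>
    (\<forall>I'. left_ideal I' A \<and> I \<subseteq> I' \<longrightarrow> I' = I \<or> I' = carrier A)"

definition jacobson_radical :: "('a, 'm) ring_scheme \<Rightarrow> 'a set"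
  where "jacobson_radical A = carrier A \<inter> \<Inter> {I. maximal_left_ideal I A}"

primrec rad_pow :: "('a, 'm) ring_scheme \<Rightarrow> nat \<Rightarrow> 'a set" where
  "rad_pow A 0 = carrier A"
| "rad_pow A (Suc m) = ideal_prod A (rad_pow A m) (jacobson_radical A)"

definition primitive_idempotent :: "('a, 'm) ring_scheme \<Rightarrow> 'a \<Rightarrow> bool"
  where "primitive_idempotent A x \<longleftrightarrow>
    x \<in> carrier A \<and> x \<otimes>\<^bsub>A\<^esub> x = x \<and> x \<noteq> \<zero>\<^bsub>A\<^esub> \<and>
    \<not> (\<exists>f\<in>carrier A. \<exists>g\<in>carrier A. f \<otimes>\<^bsub>A\<^esub> f = f \<and> g \<otimes>\<^bsub>A\<^esub> g = g \<and>
         f \<otimes>\<^bsub>A\<^esub> g = \<zero>\<^bsub>A\<^esub> \<and> g \<otimes>\<^bsub>A\<^esub> f = \<zero>\<^bsub>A\<^esub> \<and>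
         f \<noteq> \<zero>\<^bsub>A\<^esub> \<and> g \<noteq> \<zero>\<^bsub>A\<^esub> \<and> x = f \<oplus>\<^bsub>A\<^esub> g)"

definition complete_primitive_idempotents :: "('a, 'm) ring_scheme \<Rightarrow> nat \<Rightarrow> (nat \<Rightarrow> 'a) \<Rightarrow> bool"
  where "complete_primitive_idempotents A t e \<longleftrightarrow>
    (\<forall>h\<in>{1..t}. primitive_idempotent A (e h)) \<and>
    (\<forall>h\<in>{1..t}. \<forall>h'\<in>{1..t}. h \<noteq> h' \<longrightarrow> e h \<otimes>\<^bsub>A\<^esub> e h' = \<zero>\<^bsub>A\<^esub>) \<and>
    (\<Oplus>\<^bsub>A\<^esub>h\<in>{1..t}. e h) = \<one>\<^bsub>A\<^esub>"

definition proj :: "('a, 'm) ring_scheme \<Rightarrow> 'a \<Rightarrow> ('a, 'a) module"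
  where "proj A x = left_ideal_module A ((\<lambda>a. a \<otimes>\<^bsub>A\<^esub> x) ` carrier A)"

definition basic :: "('a, 'm) ring_scheme \<Rightarrow> nat \<Rightarrow> (nat \<Rightarrow> 'a) \<Rightarrow> bool"
  where "basic A t e \<longleftrightarrow>
    (\<forall>h\<in>{1..t}. \<forall>h'\<in>{1..t}. h \<noteq> h' \<longrightarrow> \<not> module_iso A (proj A (e h)) (proj A (e h')))"

definition peirce :: "('a, 'm) ring_scheme \<Rightarrow> 'a \<Rightarrow> 'a set \<Rightarrow> 'a \<Rightarrow> 'a set"
  where "peirce A x I y = (\<lambda>a. x \<otimes>\<^bsub>A\<^esub> a \<otimes>\<^bsub>A\<^esub> y) ` I"

definition corner_ring :: "('a, 'm) ring_scheme \<Rightarrow> 'a \<Rightarrow> ('a, 'm) ring_scheme"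
  where "corner_ring A x = A\<lparr>carrier := peirce A x (carrier A) x, one := x\<rparr>"

definition division_alg :: "('a, 'm) ring_scheme \<Rightarrow> 'a \<Rightarrow> 'a set ring"
  where "division_alg A x = corner_ring A x Quot peirce A x (jacobson_radical A) x"


section \<open>The bimodule \<open>e\<^sub>j J\<^sup>n\<^sup>-\<^sup>1 e\<^sub>i\<close> and its Grassmannians\<close>

text \<open>
  A scalar in \<open>D\<^sub>h\<close> is a coset.  It acts through any of its representatives; all of them act
  in the same way on \<open>e\<^sub>j J\<^sup>n\<^sup>-\<^sup>1 e\<^sub>i\<close> when \<open>J\<^sup>n = 0\<close>, so the images below are singletons.
\<close>

definition coset_lmult :: "('a, 'm) ring_scheme \<Rightarrow> 'a set \<Rightarrow> 'a \<Rightarrow> 'a"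
  where "coset_lmult A C v = the_elem ((\<lambda>x. x \<otimes>\<^bsub>A\<^esub> v) ` C)"

definition coset_rmult :: "('a, 'm) ring_scheme \<Rightarrow> 'a \<Rightarrow> 'a set \<Rightarrow> 'a"
  where "coset_rmult A v C = the_elem ((\<lambda>x. v \<otimes>\<^bsub>A\<^esub> x) ` C)"

text \<open>Here and below \<open>x\<close>, \<open>y\<close> play the roles of \<open>e\<^sub>j\<close>, \<open>e\<^sub>i\<close>.\<close>

definition top_bimodule :: "('a, 'm) ring_scheme \<Rightarrow> nat \<Rightarrow> 'a \<Rightarrow> 'a \<Rightarrow> ('a set, 'a) module"
  where "top_bimodule A n x y =
    mk_module (peirce A x (rad_pow A (n - 1)) y) (add A) \<zero>\<^bsub>A\<^esub> (coset_lmult A)"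

definition top_dim :: "('a, 'm) ring_scheme \<Rightarrow> nat \<Rightarrow> 'a \<Rightarrow> 'a \<Rightarrow> nat"
  where "top_dim A n x y = module_dim (division_alg A x) (top_bimodule A n x y)"

text \<open>The Grassmannian is indexed by the codimension \<open>s\<close>.\<close>

definition top_Gr :: "('a, 'm) ring_scheme \<Rightarrow> nat \<Rightarrow> nat \<Rightarrow> 'a \<Rightarrow> 'a \<Rightarrow> 'a set set"
  where "top_Gr A n s x y =
    {U. submodule U (division_alg A x) (top_bimodule A n x y) \<and>
        module_dim (division_alg A x) (quot_module (top_bimodule A n x y) U) = s}"

definition right_translate :: "('a, 'm) ring_scheme \<Rightarrow> 'a set \<Rightarrow> 'a set \<Rightarrow> 'a set"
  where "right_translate A U a = (\<lambda>u. coset_rmult A u a) ` U"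

definition right_group_action :: "('g, 'c) monoid_scheme \<Rightarrow> 'x set \<Rightarrow> ('x \<Rightarrow> 'g \<Rightarrow> 'x) \<Rightarrow> bool"
  where "right_group_action G E act \<longleftrightarrow> group G \<and>
    (\<forall>x\<in>E. \<forall>g\<in>carrier G. act x g \<in> E) \<and>
    (\<forall>x\<in>E. act x \<one>\<^bsub>G\<^esub> = x) \<and>
    (\<forall>x\<in>E. \<forall>g\<in>carrier G. \<forall>h\<in>carrier G. act x (g \<otimes>\<^bsub>G\<^esub> h) = act (act x g) h)"


section \<open>The terminal ambiguity fibre\<close>

definition W_sum :: "('a, 'm) ring_scheme \<Rightarrow> nat \<Rightarrow> nat \<Rightarrow> (nat \<Rightarrow> 'a) \<Rightarrow> nat \<Rightarrow> nat \<Rightarrow> 'a set"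
  where "W_sum A n t e i j =
    {(\<Oplus>\<^bsub>A\<^esub>h\<in>{1..t} - {j}. w h) | w.
       \<forall>h\<in>{1..t} - {j}. w h \<in>
         (\<lambda>p. e h \<otimes>\<^bsub>A\<^esub> p) ` ideal_prod A (rad_pow A (n - 1)) (carrier (proj A (e i)))}"

definition K_sub ::
  "('a, 'm) ring_scheme \<Rightarrow> nat \<Rightarrow> nat \<Rightarrow> (nat \<Rightarrow> 'a) \<Rightarrow> nat \<Rightarrow> nat \<Rightarrow> 'a set \<Rightarrow> 'a set"
  where "K_sub A n t e i j U = W_sum A n t e i j <+>\<^bsub>A\<^esub> U"

definition M_quot ::
  "('a, 'm) ring_scheme \<Rightarrow> nat \<Rightarrow> nat \<Rightarrow> (nat \<Rightarrow> 'a) \<Rightarrow> nat \<Rightarrow> nat \<Rightarrow> 'a set \<Rightarrow> ('a, 'a set) module"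
  where "M_quot A n t e i j U = quot_module (proj A (e i)) (K_sub A n t e i j U)"

definition fibre_modules ::
  "('a, 'm) ring_scheme \<Rightarrow> nat \<Rightarrow> nat \<Rightarrow> (nat \<Rightarrow> 'a) \<Rightarrow> nat \<Rightarrow> nat \<Rightarrow> nat \<Rightarrow> ('a, 'a set) module set"
  where "fibre_modules A n t e i j s = M_quot A n t e i j ` top_Gr A n s (e j) (e i)"

definition module_iso_rel ::
  "('r, 'c) ring_scheme \<Rightarrow> ('r, 'b) module set \<Rightarrow> (('r, 'b) module \<times> ('r, 'b) module) set"
  where "module_iso_rel R S = {(M, N). M \<in> S \<and> N \<in> S \<and> module_iso R M N}"

definition terminal_fibre ::
  "('a, 'm) ring_scheme \<Rightarrow> nat \<Rightarrow> nat \<Rightarrow> (nat \<Rightarrow> 'a) \<Rightarrow> nat \<Rightarrow> nat \<Rightarrow> nat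
     \<Rightarrow> ('a, 'a set) module set set"
  where "terminal_fibre A n t e i j s =
    fibre_modules A n t e i j s // module_iso_rel A (fibre_modules A n t e i j s)"

definition iso_class ::
  "('a, 'm) ring_scheme \<Rightarrow> nat \<Rightarrow> nat \<Rightarrow> (nat \<Rightarrow> 'a) \<Rightarrow> nat \<Rightarrow> nat \<Rightarrow> nat \<Rightarrow> 'a set
     \<Rightarrow> ('a, 'a set) module set"
  where "iso_class A n t e i j s U =
    module_iso_rel A (fibre_modules A n t e i j s) `` {M_quot A n t e i j U}"

end

theory Submission
  imports Defs
begin

text \<open>
  Write \<open>J\<close> for the radical, \<open>P\<^sub>i = \<Lambda> e\<^sub>i\<close> and \<open>V = e\<^sub>j J\<^bsup>n-1\<^esup> e\<^sub>i\<close>.  The module \<open>M\<^sub>U = P\<^sub>i / K\<^sub>U\<close> is cyclic,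
  generated by the image of \<open>e\<^sub>i\<close>, so a homomorphism \<open>M\<^sub>U \<rightarrow> M\<^bsub>U'\<^esub>\<close> is induced by right multiplication by
  some \<open>x \<in> e\<^sub>i \<Lambda> e\<^sub>i\<close>.  Such a multiplication commutes with the left action of \<open>e\<^sub>j\<close>, and membership in
  \<open>K\<^sub>U\<close> is decided by the \<open>e\<^sub>j\<close>-component alone (lemma \<open>K_iff\<close>): an element of \<open>J\<^bsup>n-1\<^esup> P\<^sub>i\<close> lies in
  \<open>K\<^sub>U\<close> exactly when its \<open>e\<^sub>j\<close>-component lies in \<open>U\<close>.  Hence a unit \<open>x\<close> carries \<open>K\<^sub>U\<close> to \<open>K\<^bsub>U x\<^esub>\<close> and
  induces \<open>M\<^sub>U \<cong> M\<^bsub>U x\<^esub>\<close> (lemma \<open>M_iso_of_unit\<close>).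

  Conversely, let \<open>x\<close> induce an isomorphism (lemma \<open>M_iso_lift\<close>).  The ring \<open>e\<^sub>i \<Lambda> e\<^sub>i\<close> is local, so
  \<open>x\<close> is a unit or radical.  In the second case surjectivity yields \<open>w\<close> with \<open>w x - e\<^sub>i \<in> K\<^bsub>U'\<^esub>\<close>, where
  \<open>w x\<close> is radical, and then \<open>e\<^sub>i \<in> K\<^bsub>U'\<^esub>\<close>.  This forces \<open>U' = V\<close>, which contradicts \<open>s \<ge> 1\<close>.  So \<open>x\<close> is
  a unit, and comparing \<open>e\<^sub>j\<close>-components gives \<open>U' = U x\<close> (lemma \<open>unit_of_M_iso\<close>).  Because \<open>V J = 0\<close>
  and units lift along \<open>e\<^sub>i \<Lambda> e\<^sub>i \<rightarrow> D\<^sub>i\<close>, translation by \<open>x\<close> is translation by an element of the unit group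
  of \<open>D\<^sub>i\<close>, and every such element arises.  It preserves codimension since it is a \<open>D\<^sub>j\<close>-automorphism of
  \<open>V\<close>.

  Three facts about the algebra carry the argument.  The radical is a two-sided ideal that
  contains every nil left ideal.  A corner at a primitive idempotent is local: by finite dimension
  the powers of \<open>x\<close> are dependent, which gives \<open>x\<^sup>k = x\<^bsup>2k\<^esup> y\<close> with \<open>y\<close> commuting with \<open>x\<close>, and the
  idempotent \<open>x\<^sup>k y\<close> of the corner can only be \<open>0\<close> or the identity.  For a basic algebra
  \<open>e\<^sub>h \<Lambda> e\<^bsub>h'\<^esub> \<subseteq> J\<close> when \<open>h \<noteq> h'\<close>, since an element outside \<open>J\<close> would be invertible and identify \<open>\<Lambda> e\<^sub>h\<close>
  with \<open>\<Lambda> e\<^bsub>h'\<^esub>\<close>; as \<open>J J\<^bsup>n-1\<^esup> = 0\<close>, this is what makes \<open>K\<^sub>U\<close> a submodule.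
\<close>

section \<open>Left ideals and the Jacobson radical\<close>

lemma mk_module_simps [simp]:
  "carrier (mk_module S a z sm) = S" "add (mk_module S a z sm) = a"
  "ring.zero (mk_module S a z sm) = z" "smult (mk_module S a z sm) = sm"
  by (simp_all add: mk_module_def)

lemma left_ideal_module_simps [simp]:
  "carrier (left_ideal_module R I) = I" "add (left_ideal_module R I) = add R"
  "ring.zero (left_ideal_module R I) = ring.zero R" "smult (left_ideal_module R I) = monoid.mult R"
  by (simp_all add: left_ideal_module_def)

context ring
begin

lemma add_minus_cancel_left:
  assumes "p \<in> carrier R" "q \<in> carrier R"
  shows "(p \<oplus> q) \<ominus> p = q"
  using assms by algebra

lemma finsum_in_additive_subgroup:
  assumes S: "additive_subgroup S R" and "finite F" "\<And>h. h \<in> F \<Longrightarrow> w h \<in> S"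
  shows "(\<Oplus>h\<in>F. w h) \<in> S"
  using assms(2,3)
proof (induction F rule: finite_induct)
  case empty
  then show ?case using additive_subgroup.zero_closed[OF S] by simp
next
  case (insert h F)
  have "(\<Oplus>h\<in>insert h F. w h) = w h \<oplus> (\<Oplus>h\<in>F. w h)"
    using insert.hyps insert.prems additive_subgroup.a_Hcarr[OF S] by (intro finsum_insert) auto
  then show ?case
    using additive_subgroup.a_closed[OF S, of "w h"] insert.IH insert.prems by simp
qed

lemma regular_module_subgroup_iff:
  "subgroup I (add_monoid (left_ideal_module R (carrier R))) \<longleftrightarrow> additive_subgroup I R"
  unfolding additive_subgroup_def subgroup_def m_inv_def left_ideal_module_simps
    monoid.select_convs partial_object.select_convs by (rule refl)

lemma left_idealI:
  assumes "additive_subgroup I R"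
    and "\<And>a x. a \<in> carrier R \<Longrightarrow> x \<in> I \<Longrightarrow> a \<otimes> x \<in> I"
  shows "left_ideal I R"
proof (rule submodule.intro)
  show "subgroup I (add_monoid (left_ideal_module R (carrier R)))"
    using assms(1) by (simp only: regular_module_subgroup_iff)
  show "submodule_axioms I R (left_ideal_module R (carrier R))"
    by (intro submodule_axioms.intro) (simp add: assms(2))
qed

lemma left_idealD:
  assumes "left_ideal I R"
  shows "additive_subgroup I R"
    and "a \<in> carrier R \<Longrightarrow> x \<in> I \<Longrightarrow> a \<otimes> x \<in> I"
proof -
  show "additive_subgroup I R"
    using submodule.axioms(1)[OF assms] by (simp only: regular_module_subgroup_iff)
  show "a \<in> carrier R \<Longrightarrow> x \<in> I \<Longrightarrow> a \<otimes> x \<in> I"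
    using submodule.smult_closed[OF assms, of a x] by simp
qed

lemma left_ideal_eq_carrier:
  assumes "left_ideal I R" "\<one> \<in> I"
  shows "I = carrier R"
proof
  show "I \<subseteq> carrier R" using left_idealD(1)[OF assms(1)] by (rule additive_subgroup.a_subset)
  show "carrier R \<subseteq> I" using left_idealD(2)[OF assms(1) _ assms(2)] by auto
qed

text \<open>The left ideal \<open>R x + I\<close> is strictly above \<open>I\<close>, so it is everything.\<close>
lemma maximal_left_ideal_complement:
  assumes "maximal_left_ideal I R" "x \<in> carrier R" "x \<notin> I"
  obtains a y where "a \<in> carrier R" "y \<in> I" "\<one> = a \<otimes> x \<oplus> y"
proof -
  have I: "left_ideal I R" and max: "\<And>I'. left_ideal I' R \<Longrightarrow> I \<subseteq> I' \<Longrightarrow> I' = I \<or> I' = carrier R"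
    using assms(1) by (auto simp: maximal_left_ideal_def)
  interpret I: additive_subgroup I R by (rule left_idealD(1)[OF I])
  let ?L = "{a \<otimes> x \<oplus> y |a y. a \<in> carrier R \<and> y \<in> I}"
  have "left_ideal ?L R"
  proof (rule left_idealI, rule additive_subgroupI, rule add.subgroupI)
    show "?L \<subseteq> carrier R" using assms(2) by auto
    show "?L \<noteq> {}" using I.zero_closed by blast
  next
    fix z assume "z \<in> ?L"
    then obtain a y where z: "z = a \<otimes> x \<oplus> y" "a \<in> carrier R" "y \<in> I" by blast
    then have "\<ominus> z = (\<ominus> a) \<otimes> x \<oplus> (\<ominus> y)"
      using assms(2) by (simp add: minus_add l_minus)
    then show "\<ominus> z \<in> ?L" using z by blast
  next
    fix z z' assume "z \<in> ?L" "z' \<in> ?L"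
    then obtain a y a' y' where z: "z = a \<otimes> x \<oplus> y" "a \<in> carrier R" "y \<in> I"
      "z' = a' \<otimes> x \<oplus> y'" "a' \<in> carrier R" "y' \<in> I" by blast
    then have "z \<oplus> z' = (a \<oplus> a') \<otimes> x \<oplus> (y \<oplus> y')"
      using assms(2) by (simp add: l_distr a_ac)
    then show "z \<oplus> z' \<in> ?L" using z by blast
  next
    fix b z assume b: "b \<in> carrier R" and "z \<in> ?L"
    then obtain a y where z: "z = a \<otimes> x \<oplus> y" "a \<in> carrier R" "y \<in> I" by blast
    then have "b \<otimes> z = (b \<otimes> a) \<otimes> x \<oplus> b \<otimes> y"
      using assms(2) b by (simp add: r_distr m_assoc)
    then show "b \<otimes> z \<in> ?L" using z b left_idealD(2)[OF I] by blast
  qed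
  moreover have "I \<subseteq> ?L"
  proof
    fix y assume "y \<in> I"
    then have "y = \<zero> \<otimes> x \<oplus> y" using assms(2) by simp
    then show "y \<in> ?L" using \<open>y \<in> I\<close> by blast
  qed
  moreover have "x \<in> ?L"
  proof -
    have "x = \<one> \<otimes> x \<oplus> \<zero>" using assms(2) by simp
    then show ?thesis using I.zero_closed by blast
  qed
  ultimately have "?L = carrier R" using max[of ?L] assms(3) by blast
  then have "\<one> \<in> ?L" by simp
  then show ?thesis using that by blast
qed

lemma in_jacobson_radical_iff:
  "x \<in> jacobson_radical R \<longleftrightarrow> x \<in> carrier R \<and> (\<forall>I. maximal_left_ideal I R \<longrightarrow> x \<in> I)"
  by (auto simp: jacobson_radical_def)

text \<open>For a maximal left ideal \<open>I\<close> and \<open>r \<notin> I\<close>, the left ideal \<open>{a. a r \<in> I}\<close> is again maximal;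
  this is why an intersection of \<^emph>\<open>left\<close> ideals is closed under multiplication from the right.\<close>
lemma maximal_left_ideal_transporter:
  assumes "maximal_left_ideal I R" "r \<in> carrier R" "r \<notin> I"
  shows "maximal_left_ideal {a \<in> carrier R. a \<otimes> r \<in> I} R"
proof -
  let ?T = "{a \<in> carrier R. a \<otimes> r \<in> I}"
  have I: "left_ideal I R" using assms(1) by (simp add: maximal_left_ideal_def)
  interpret I: additive_subgroup I R by (rule left_idealD(1)[OF I])
  have T: "left_ideal ?T R"
  proof (rule left_idealI, rule additive_subgroupI, rule add.subgroupI)
    show "?T \<noteq> {}" using assms(2) by (auto intro!: exI[of _ \<zero>])
  qed (use assms(2) left_idealD(2)[OF I] in \<open>auto simp: l_minus l_distr m_assoc\<close>)
  moreover have "?T \<noteq> carrier R"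
    using assms(2,3) one_closed l_one by (metis (no_types, lifting) mem_Collect_eq)
  moreover have "I' = ?T \<or> I' = carrier R" if I': "left_ideal I' R" and sub: "?T \<subseteq> I'" for I'
  proof (cases "I' \<subseteq> ?T")
    case True then show ?thesis using sub by blast
  next
    case False
    interpret I': additive_subgroup I' R by (rule left_idealD(1)[OF I'])
    obtain b where b: "b \<in> I'" "b \<in> carrier R" "b \<otimes> r \<notin> I"
      using False I'.a_subset by blast
    obtain c y where c: "c \<in> carrier R" "y \<in> I" "\<one> = c \<otimes> (b \<otimes> r) \<oplus> y"
      using maximal_left_ideal_complement[OF assms(1), of "b \<otimes> r"] b assms(2) by auto
    define d where "d = r \<otimes> c \<otimes> b"
    have d: "d \<in> I'" "d \<in> carrier R"
      using b c assms(2) left_idealD(2)[OF I'] by (auto simp: d_def)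
    have "r = r \<otimes> \<one>" using assms(2) by simp
    also have "\<dots> = d \<otimes> r \<oplus> r \<otimes> y"
      using b c assms(2) by (simp only: c(3)) (simp add: r_distr m_assoc d_def)
    finally have req: "r = d \<otimes> r \<oplus> r \<otimes> y" .
    have "(\<one> \<ominus> d) \<otimes> r = r \<ominus> d \<otimes> r"
      using assms(2) d by (simp add: l_distr minus_eq l_minus)
    also have "\<dots> = (d \<otimes> r \<oplus> r \<otimes> y) \<ominus> d \<otimes> r" using req by simp
    also have "\<dots> = r \<otimes> y"
      using assms(2) c(2) d I.a_Hcarr by (intro add_minus_cancel_left) auto
    finally have "(\<one> \<ominus> d) \<otimes> r \<in> I"
      using left_idealD(2)[OF I] assms(2) c(2) by simp
    then have "\<one> \<ominus> d \<in> I'" using sub d by auto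
    then have "(\<one> \<ominus> d) \<oplus> d \<in> I'" using d by blast
    then have "\<one> \<in> I'" using d by (simp add: minus_eq a_assoc l_neg)
    then show ?thesis using left_ideal_eq_carrier[OF I'] by blast
  qed
  ultimately show ?thesis by (simp add: maximal_left_ideal_def)
qed

lemma jacobson_radical_ideal: "ideal (jacobson_radical R) R"
proof (rule idealI[OF ring_axioms])
  have sub: "additive_subgroup I R" if "maximal_left_ideal I R" for I
    using that by (intro left_idealD(1)) (simp add: maximal_left_ideal_def)
  show "subgroup (jacobson_radical R) (add_monoid R)"
  proof (rule add.subgroupI)
    show "jacobson_radical R \<noteq> {}"
      using additive_subgroup.zero_closed[OF sub] in_jacobson_radical_iff[of \<zero>] by auto
  qed (use additive_subgroup.a_inv_closed[OF sub] additive_subgroup.a_closed[OF sub]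
        in \<open>auto simp: in_jacobson_radical_iff\<close>)
next
  fix a x assume "a \<in> jacobson_radical R" "x \<in> carrier R"
  then show "x \<otimes> a \<in> jacobson_radical R"
    using left_idealD(2)[of _ x a] by (simp add: in_jacobson_radical_iff maximal_left_ideal_def)
next
  fix a x assume a: "a \<in> jacobson_radical R" and x: "x \<in> carrier R"
  have "a \<otimes> x \<in> I" if I: "maximal_left_ideal I R" for I
  proof (cases "x \<in> I")
    case True
    then show ?thesis
      using I a left_idealD(2)[of I a x] by (simp add: maximal_left_ideal_def in_jacobson_radical_iff)
  next
    case False
    then show ?thesis
      using maximal_left_ideal_transporter[OF I x] a by (auto simp: in_jacobson_radical_iff)
  qed
  then show "a \<otimes> x \<in> jacobson_radical R"
    using a x by (auto simp: in_jacobson_radical_iff)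
qed

text \<open>The inverse is the geometric series \<open>1 + z + \<dots> + z\<^bsup>m-1\<^esup>\<close>.\<close>
lemma one_minus_nilpotent_unit:
  assumes "z \<in> carrier R" "z [^] (m::nat) = \<zero>"
  obtains w where "w \<in> carrier R" "w \<otimes> (\<one> \<ominus> z) = \<one>" "(\<one> \<ominus> z) \<otimes> w = \<one>"
proof -
  have "\<exists>w\<in>carrier R. w \<otimes> (\<one> \<ominus> z) = \<one> \<ominus> z [^] k \<and> (\<one> \<ominus> z) \<otimes> w = \<one> \<ominus> z [^] k" for k :: nat
  proof (induction k)
    case 0
    then show ?case using assms(1) by (intro bexI[of _ \<zero>]) (auto simp: minus_eq r_neg)
  next
    case (Suc k)
    then obtain w where w: "w \<in> carrier R" "w \<otimes> (\<one> \<ominus> z) = \<one> \<ominus> z [^] k"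
      "(\<one> \<ominus> z) \<otimes> w = \<one> \<ominus> z [^] k" by blast
    define p where "p = z [^] k"
    have p: "p \<in> carrier R" "z [^] Suc k = p \<otimes> z" "z [^] Suc k = z \<otimes> p"
      using assms(1) nat_pow_Suc2[of z k] by (auto simp: p_def)
    have telescope: "\<one> \<ominus> p \<oplus> (p \<ominus> q) = \<one> \<ominus> q" if "q \<in> carrier R" for q
      using p(1) that by algebra
    have "p \<otimes> (\<one> \<ominus> z) = p \<ominus> p \<otimes> z" "(\<one> \<ominus> z) \<otimes> p = p \<ominus> z \<otimes> p"
      using assms(1) p(1) by (simp_all add: minus_eq l_distr r_distr l_minus r_minus)
    then have "(w \<oplus> p) \<otimes> (\<one> \<ominus> z) = \<one> \<ominus> z [^] Suc k \<and> (\<one> \<ominus> z) \<otimes> (w \<oplus> p) = \<one> \<ominus> z [^] Suc k"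
      using w p assms(1) telescope[of "p \<otimes> z"] telescope[of "z \<otimes> p"]
      by (simp add: l_distr r_distr p_def[symmetric] del: nat_pow_Suc)
    then show ?case using w(1) p(1) by blast
  qed
  from this[of m] show thesis using that assms by (auto simp: minus_eq)
qed

text \<open>If a maximal left ideal misses \<open>x\<close>, it contains some \<open>1 - a x\<close>, which is a unit because \<open>a x\<close>
  is nilpotent.\<close>
lemma nil_left_ideal_in_jacobson_radical:
  assumes "x \<in> carrier R" "\<And>r. r \<in> carrier R \<Longrightarrow> \<exists>m::nat. (r \<otimes> x) [^] m = \<zero>"
  shows "x \<in> jacobson_radical R"
proof (rule ccontr)
  assume "x \<notin> jacobson_radical R"
  then obtain I where I: "maximal_left_ideal I R" "x \<notin> I"
    using assms(1) by (auto simp: in_jacobson_radical_iff)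
  then obtain a y where ay: "a \<in> carrier R" "y \<in> I" "\<one> = a \<otimes> x \<oplus> y"
    using maximal_left_ideal_complement[OF I(1) assms(1) I(2)] by metis
  have L: "left_ideal I R" using I by (simp add: maximal_left_ideal_def)
  have y: "y \<in> carrier R" by (rule additive_subgroup.a_Hcarr[OF left_idealD(1)[OF L] ay(2)])
  have "\<one> \<ominus> a \<otimes> x = (a \<otimes> x \<oplus> y) \<ominus> a \<otimes> x" by (simp only: ay(3)[symmetric])
  also have "\<dots> = y" using ay(1) assms(1) y by (intro add_minus_cancel_left) auto
  finally have yeq: "\<one> \<ominus> a \<otimes> x = y" .
  obtain m :: nat where "(a \<otimes> x) [^] m = \<zero>" using assms(2) ay(1) by blast
  then obtain w where "w \<in> carrier R" "w \<otimes> (\<one> \<ominus> a \<otimes> x) = \<one>"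
    using one_minus_nilpotent_unit[OF m_closed[OF ay(1) assms(1)]] by metis
  then have "\<one> \<in> I" using yeq left_idealD(2)[OF L _ ay(2)] by metis
  then have "I = carrier R" by (rule left_ideal_eq_carrier[OF L])
  then show False using I(1) by (simp add: maximal_left_ideal_def)
qed

lemma rad_pow_ideal: "ideal (rad_pow R m) R"
  by (induction m) (simp_all add: oneideal ideal_prod_is_ideal jacobson_radical_ideal)

lemma rad_pow_mult_right:
  assumes "x \<in> rad_pow R m" "z \<in> jacobson_radical R"
  shows "x \<otimes> z \<in> rad_pow R (Suc m)"
  using assms by (simp add: ideal_prod.prod)

text \<open>The powers of \<open>J\<close> are formed by multiplying from the right; by associativity of the ideal
  product the side is immaterial, so \<open>J\<^sup>n = 0\<close> makes \<open>J\<^bsup>n-1\<^esup>\<close> killed by \<open>J\<close> on both sides.\<close>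
lemma jacobson_prod_rad_pow: "ideal_prod R (jacobson_radical R) (rad_pow R m) = rad_pow R (Suc m)"
proof (induction m)
  case 0
  interpret J: ideal "jacobson_radical R" R by (rule jacobson_radical_ideal)
  have "x \<in> ideal_prod R (jacobson_radical R) (carrier R)"
    "x \<in> ideal_prod R (carrier R) (jacobson_radical R)" if "x \<in> jacobson_radical R" for x
    using ideal_prod.prod[of x "jacobson_radical R" \<one> "carrier R" R]
      ideal_prod.prod[of \<one> "carrier R" x "jacobson_radical R" R] that by auto
  then show ?case
    using ideal_prod_inter[OF jacobson_radical_ideal oneideal]
      ideal_prod_inter[OF oneideal jacobson_radical_ideal] by auto
next
  case (Suc m)
  have "ideal_prod R (jacobson_radical R) (rad_pow R (Suc m))
      = ideal_prod R (ideal_prod R (jacobson_radical R) (rad_pow R m)) (jacobson_radical R)"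
    by (simp add: ideal_prod_assoc[OF jacobson_radical_ideal rad_pow_ideal jacobson_radical_ideal])
  then show ?case using Suc by simp
qed

lemma rad_pow_mult_left:
  assumes "x \<in> rad_pow R m" "z \<in> jacobson_radical R"
  shows "z \<otimes> x \<in> rad_pow R (Suc m)"
  using ideal_prod.prod[OF assms(2,1)] jacobson_prod_rad_pow by metis

lemma jacobson_pow_in_rad_pow:
  assumes "z \<in> jacobson_radical R"
  shows "z [^] m \<in> rad_pow R m"
proof (induction m)
  case (Suc m)
  then show ?case using rad_pow_mult_right[OF Suc assms] by simp
qed simp

end

section \<open>Primitive idempotents in a finite-dimensional algebra\<close>

context ring
begin

text \<open>Otherwise \<open>1, x, \<dots>, x\<^sup>d\<close>, adjoined from the top power downwards, would be \<open>d + 1\<close> independent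
  vectors.\<close>
lemma pow_in_Span_of_higher_powers:
  assumes F: "subfield F R" and dim: "dimension d F (carrier R)" and x: "x \<in> carrier R"
  obtains k :: nat and ks :: "nat list"
    where "x [^] k \<in> Span F (map (\<lambda>m. x [^] Suc (k + m)) ks)"
proof -
  define L where "L = (\<lambda>a. map (\<lambda>m. x [^] (m::nat)) [a..<Suc d])"
  have "\<exists>k. k \<le> d \<and> x [^] k \<in> Span F (L (Suc k))"
  proof (rule ccontr)
    assume none: "\<not> ?thesis"
    have "independent F (L (Suc d - m))" if "m \<le> Suc d" for m
      using that
    proof (induction m)
      case 0 then show ?case by (simp add: L_def)
    next
      case (Suc m)
      have "L (Suc d - Suc m) = x [^] (d - m) # L (Suc (d - m))"
        using Suc.prems by (simp add: L_def upt_conv_Cons del: upt_Suc)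
      moreover have "Suc (d - m) = Suc d - m" using Suc.prems by simp
      moreover have "x [^] (d - m) \<notin> Span F (L (Suc (d - m)))" using none by auto
      ultimately show ?case
        using Suc x li_Cons[of "x [^] (d - m)" F "L (Suc (d - m))"] by (simp del: Span.simps)
    qed
    from this[of "Suc d"] have "independent F (L 0)" by simp
    moreover have "set (L 0) \<subseteq> carrier R" using x by (auto simp: L_def simp del: upt_Suc)
    ultimately have "length (L 0) \<le> d"
      using independent_length_le_dimension[OF F dim] by blast
    then show False by (simp add: L_def)
  qed
  then obtain k where k: "k \<le> d" "x [^] k \<in> Span F (L (Suc k))" by blast
  moreover have "L (Suc k) = map (\<lambda>m. x [^] Suc (k + m)) [0..<d - k]"
  proof -
    have "[Suc k..<Suc d] = map (\<lambda>m. m + Suc k) [0..<d - k]"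
      using k(1) map_add_upt[of "Suc k" "d - k"] by (simp del: upt_Suc)
    then show ?thesis by (simp add: L_def add.commute comp_def del: upt_Suc)
  qed
  ultimately show thesis using that by metis
qed

text \<open>Elements of \<open>F\<close> being central, the span of the powers above \<open>x\<^sup>k\<close> lies in
  \<open>{x\<^bsup>k+1\<^esup> q. q commutes with x}\<close>.\<close>
lemma pow_eq_higher_pow_mult:
  assumes F: "subfield F R" and dim: "dimension d F (carrier R)" and x: "x \<in> carrier R"
    and central: "\<And>c y. c \<in> F \<Longrightarrow> y \<in> carrier R \<Longrightarrow> c \<otimes> y = y \<otimes> c"
  obtains k :: nat and q where "q \<in> carrier R" "q \<otimes> x = x \<otimes> q" "x [^] k = x [^] Suc k \<otimes> q"
proof -
  obtain k ks where k: "x [^] k \<in> Span F (map (\<lambda>m. x [^] Suc (k + m)) ks)"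
    using pow_in_Span_of_higher_powers[OF F dim x] by metis
  have Fc: "F \<subseteq> carrier R" by (rule subfieldE(3)[OF F])
  have "\<exists>q\<in>carrier R. q \<otimes> x = x \<otimes> q \<and> v = x [^] Suc k \<otimes> q"
    if "v \<in> Span F (map (\<lambda>m. x [^] Suc (k + m)) ks)" for v
    using that
  proof (induction ks arbitrary: v)
    case Nil
    then show ?case using x by (intro bexI[of _ \<zero>]) auto
  next
    case (Cons m ks)
    then obtain c w where c: "c \<in> F" and w: "w \<in> Span F (map (\<lambda>m. x [^] Suc (k + m)) ks)"
      and v: "v = c \<otimes> x [^] Suc (k + m) \<oplus> w"
      by (auto simp: line_extension_mem_iff simp del: nat_pow_Suc)
    obtain q where q: "q \<in> carrier R" "q \<otimes> x = x \<otimes> q" "w = x [^] Suc k \<otimes> q"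
      using Cons.IH[OF w] by blast
    have cc: "c \<in> carrier R" using c Fc by blast
    define p where "p = x [^] m"
    have p: "p \<in> carrier R" "p \<otimes> x = x \<otimes> p"
      using x nat_pow_comm[of x m 1] by (simp_all add: p_def)
    define y where "y = x [^] Suc k"
    have y: "y \<in> carrier R" using x by (simp add: y_def)
    have pow: "x [^] Suc (k + m) = y \<otimes> p"
      using x nat_pow_mult[of x "Suc k" m] by (simp add: y_def p_def del: nat_pow_Suc)
    have "v = y \<otimes> (c \<otimes> p \<oplus> q)"
      using cc p y q central[OF c y] unfolding v pow q(3) y_def[symmetric]
      by (simp add: r_distr m_assoc[symmetric])
    moreover have "(c \<otimes> p \<oplus> q) \<otimes> x = x \<otimes> (c \<otimes> p \<oplus> q)"
    proof -
      have "(c \<otimes> p) \<otimes> x = c \<otimes> (x \<otimes> p)" using cc p x by (simp add: m_assoc)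
      also have "\<dots> = x \<otimes> (c \<otimes> p)" using cc p x central[OF c x] by (simp add: m_assoc[symmetric])
      finally show ?thesis using cc p q x by (simp add: l_distr r_distr)
    qed
    ultimately show ?case using cc p(1) q(1) y_def by blast
  qed
  from this[OF k] show thesis using that by blast
qed

text \<open>Substituting \<open>x\<^sup>k = x\<^bsup>k+1\<^esup> q\<close> into itself gives \<open>x\<^sup>k = x\<^bsup>k+m\<^esup> q\<^sup>m\<close> for every \<open>m\<close>.  This is
  Fitting's decomposition in element form: \<open>x\<^bsup>k+1\<^esup> y\<close> is an idempotent commuting with \<open>x\<close>, on whose
  part \<open>x\<close> is invertible, and \<open>x\<close> is nilpotent on the complementary part.  The exponent \<open>k + 1\<close>
  keeps the power in a corner that contains \<open>x\<close>.\<close>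
lemma power_eq_square_mult:
  assumes "x \<in> carrier R" "q \<in> carrier R" "q \<otimes> x = x \<otimes> q" "x [^] (k::nat) = x [^] Suc k \<otimes> q"
  obtains y where "y \<in> carrier R" "y \<otimes> x = x \<otimes> y"
    "x [^] Suc k = x [^] Suc k \<otimes> x [^] Suc k \<otimes> y"
proof -
  have comm: "q [^] m \<otimes> x = x \<otimes> q [^] m" for m :: nat
    by (rule group_commutes_pow[OF assms(3,2,1)])
  have "x [^] k = x [^] (k + m) \<otimes> q [^] m" for m
  proof (induction m)
    case (Suc m)
    have "x [^] k = x [^] m \<otimes> x [^] k \<otimes> q [^] m"
      using Suc assms(1) nat_pow_mult[of x m k] by (simp add: add.commute)
    also have "\<dots> = x [^] m \<otimes> (x [^] Suc k \<otimes> q) \<otimes> q [^] m" by (simp only: assms(4)[symmetric])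
    also have "\<dots> = (x [^] m \<otimes> x [^] Suc k) \<otimes> (q \<otimes> q [^] m)"
      using assms(1,2) by (simp add: m_assoc del: nat_pow_Suc)
    also have "\<dots> = x [^] (k + Suc m) \<otimes> q [^] Suc m"
      using assms(1,2) nat_pow_mult[of x m "Suc k"] nat_pow_Suc2[of q m]
      by (simp add: add.commute del: nat_pow_Suc)
    finally show ?case .
  qed (use assms in simp)
  from this[of "Suc k"] have eq: "x [^] k = x [^] k \<otimes> x [^] Suc k \<otimes> q [^] Suc k"
    unfolding nat_pow_mult[OF assms(1)] .
  have "x [^] Suc k = x \<otimes> x [^] k" using assms(1) by (rule nat_pow_Suc2)
  also have "\<dots> = x \<otimes> (x [^] k \<otimes> x [^] Suc k \<otimes> q [^] Suc k)" by (simp only: eq[symmetric])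
  also have "\<dots> = x [^] Suc k \<otimes> x [^] Suc k \<otimes> q [^] Suc k"
    unfolding nat_pow_Suc2[OF assms(1)] using assms(1,2) by (simp add: m_assoc)
  finally show thesis using that[of "q [^] Suc k"] comm[of "Suc k"] assms(1,2) by simp
qed

lemma primitive_idempotentD:
  assumes "primitive_idempotent R e"
  shows "e \<in> carrier R" "e \<otimes> e = e" "e \<noteq> \<zero>"
  using assms by (auto simp: primitive_idempotent_def)

text \<open>Any other idempotent \<open>f\<close> of the corner would split \<open>e\<close> as \<open>f + (e - f)\<close>.\<close>
lemma primitive_idempotent_corner:
  assumes e: "primitive_idempotent R e"
    and f: "f \<in> carrier R" "f \<otimes> f = f" "e \<otimes> f = f" "f \<otimes> e = f" "f \<noteq> \<zero>"
  shows "f = e"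
proof -
  note e' = primitive_idempotentD[OF e]
  define g where "g = e \<ominus> f"
  have g: "g \<in> carrier R" "g \<otimes> g = g" "f \<otimes> g = \<zero>" "g \<otimes> f = \<zero>" "e = f \<oplus> g"
    using e' f by (simp_all add: g_def minus_eq l_distr r_distr l_minus r_minus r_neg r_neg2 l_neg a_comm[of e])
  then have "g = \<zero>" using e f unfolding primitive_idempotent_def by blast
  then show ?thesis using g(5) f(1) by simp
qed

end

context fin_dim_algebra
begin

lemma smult_one_eq_mult:
  assumes "c \<in> carrier K" "y \<in> carrier A"
  shows "c \<odot>\<^bsub>A\<^esub> y = (c \<odot>\<^bsub>A\<^esub> \<one>\<^bsub>A\<^esub>) \<otimes>\<^bsub>A\<^esub> y" "c \<odot>\<^bsub>A\<^esub> y = y \<otimes>\<^bsub>A\<^esub> (c \<odot>\<^bsub>A\<^esub> \<one>\<^bsub>A\<^esub>)"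
  using smult_mult_left[OF assms(1) A.one_closed assms(2)]
    smult_mult_right[OF assms A.one_closed] assms by simp_all

text \<open>The image \<open>K 1\<close> of the ground field turns finite dimension over \<open>K\<close> into finite
  dimension over a central subfield of the ring.\<close>
lemma central_subfield_finite_dimension:
  assumes "\<one>\<^bsub>A\<^esub> \<noteq> \<zero>\<^bsub>A\<^esub>"
  obtains F d where "subfield F A" "A.dimension d F (carrier A)"
    "\<And>c y. c \<in> F \<Longrightarrow> y \<in> carrier A \<Longrightarrow> c \<otimes>\<^bsub>A\<^esub> y = y \<otimes>\<^bsub>A\<^esub> c"
proof -
  define h where "h = (\<lambda>c. c \<odot>\<^bsub>A\<^esub> \<one>\<^bsub>A\<^esub>)"
  define F where "F = h ` carrier K"
  have "h \<in> ring_hom K A"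
    by (intro ring_hom_memI) (simp_all add: h_def smult_l_distr smult_assoc1 smult_mult_left)
  then have hom: "ring_hom_ring K A h"
    by (intro ring_hom_ringI2) (auto intro: R.ring_axioms A.ring_axioms)
  have F: "subfield F A"
    unfolding F_def
    using ring_hom_ring.img_is_subfield(2)[OF hom K.carrier_is_subfield assms] .
  obtain B where B: "finite B" "B \<subseteq> carrier A"
    "\<And>x. x \<in> carrier A \<Longrightarrow> \<exists>c \<in> B \<rightarrow> carrier K. x = (\<Oplus>\<^bsub>A\<^esub>b\<in>B. c b \<odot>\<^bsub>A\<^esub> b)"
    using finite_dimensional unfolding module_basis_def by blast
  obtain bs where bs: "set bs = B" using B(1) finite_list by blast
  have sub: "subgroup (A.Span F bs) (add_monoid A)"
    using A.Span_is_add_subgroup[OF F] B(2) bs by simp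
  have span: "A.Span F bs = carrier A"
  proof
    show "A.Span F bs \<subseteq> carrier A" using subgroup.subset[OF sub] by simp
    show "carrier A \<subseteq> A.Span F bs"
    proof
      fix x assume "x \<in> carrier A"
      then obtain c where c: "c \<in> B \<rightarrow> carrier K" "x = (\<Oplus>\<^bsub>A\<^esub>b\<in>B. c b \<odot>\<^bsub>A\<^esub> b)"
        using B(3) by blast
      have "c b \<odot>\<^bsub>A\<^esub> b \<in> A.Span F bs" if "b \<in> B" for b
      proof -
        have b: "c b \<in> carrier K" "b \<in> carrier A" using that c(1) B(2) by auto
        have "h (c b) \<otimes>\<^bsub>A\<^esub> b \<in> A.Span F bs"
          using A.Span_base_incl[OF F] B(2) bs that b(1)
          by (intro A.Span_smult_closed[OF F]) (auto simp: F_def simp del: A.Span.simps)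
        then show ?thesis using smult_one_eq_mult(1)[OF b] by (simp add: h_def)
      qed
      then show "x \<in> A.Span F bs"
        unfolding c(2) by (rule A.finsum_in_additive_subgroup[OF additive_subgroupI[OF sub] B(1)])
    qed
  qed
  have "set bs \<subseteq> carrier A" using B(2) bs by simp
  then obtain Vs where "set Vs \<subseteq> carrier A" "A.independent F Vs" "A.Span F Vs = A.Span F bs"
    by (rule A.filter_base[OF F])
  then have "A.dimension (length Vs) F (carrier A)"
    using A.dimensionI[OF F, of Vs "carrier A"] span by (simp del: A.Span.simps)
  moreover have "c \<otimes>\<^bsub>A\<^esub> y = y \<otimes>\<^bsub>A\<^esub> c" if "c \<in> F" "y \<in> carrier A" for c y
  proof -
    obtain a where "a \<in> carrier K" "c = a \<odot>\<^bsub>A\<^esub> \<one>\<^bsub>A\<^esub>"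
      using \<open>c \<in> F\<close> unfolding F_def h_def by blast
    then show ?thesis
      using smult_one_eq_mult[of a y] \<open>y \<in> carrier A\<close> by metis
  qed
  ultimately show thesis using that F by blast
qed

text \<open>The corner \<open>e A e\<close> is local: its only idempotents are \<open>0\<close> and \<open>e\<close>, so Fitting's
  idempotent leaves two cases.\<close>
lemma corner_nilpotent_or_unit:
  assumes e: "primitive_idempotent A e"
    and x: "x \<in> carrier A" "e \<otimes>\<^bsub>A\<^esub> x = x" "x \<otimes>\<^bsub>A\<^esub> e = x"
  shows "(\<exists>m::nat. x [^]\<^bsub>A\<^esub> m = \<zero>\<^bsub>A\<^esub>) \<or> (\<exists>y\<in>carrier A. y \<otimes>\<^bsub>A\<^esub> x = e)"
proof -
  note e' = A.primitive_idempotentD[OF e]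
  have "\<one>\<^bsub>A\<^esub> \<noteq> \<zero>\<^bsub>A\<^esub>" using e'(1,3) A.one_zeroD by auto
  from central_subfield_finite_dimension[OF this]
  obtain F d where F: "subfield F A" "A.dimension d F (carrier A)"
    "\<And>c y. c \<in> F \<Longrightarrow> y \<in> carrier A \<Longrightarrow> c \<otimes>\<^bsub>A\<^esub> y = y \<otimes>\<^bsub>A\<^esub> c" by blast
  from A.pow_eq_higher_pow_mult[OF F(1,2) x(1) F(3)]
  obtain k q where "q \<in> carrier A" "q \<otimes>\<^bsub>A\<^esub> x = x \<otimes>\<^bsub>A\<^esub> q" "x [^]\<^bsub>A\<^esub> k = x [^]\<^bsub>A\<^esub> Suc k \<otimes>\<^bsub>A\<^esub> q"
    by metis
  from A.power_eq_square_mult[OF x(1) this]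
  obtain y where y: "y \<in> carrier A" "y \<otimes>\<^bsub>A\<^esub> x = x \<otimes>\<^bsub>A\<^esub> y"
    "x [^]\<^bsub>A\<^esub> Suc k = x [^]\<^bsub>A\<^esub> Suc k \<otimes>\<^bsub>A\<^esub> x [^]\<^bsub>A\<^esub> Suc k \<otimes>\<^bsub>A\<^esub> y" by metis
  define z where "z = x [^]\<^bsub>A\<^esub> Suc k"
  have z: "z \<in> carrier A" "e \<otimes>\<^bsub>A\<^esub> z = z" "z \<otimes>\<^bsub>A\<^esub> e = z" "z = z \<otimes>\<^bsub>A\<^esub> z \<otimes>\<^bsub>A\<^esub> y"
  proof -
    show "z \<in> carrier A" using x by (simp add: z_def)
    show "z \<otimes>\<^bsub>A\<^esub> e = z" using x e' by (simp add: z_def A.m_assoc)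
    have "z = x \<otimes>\<^bsub>A\<^esub> x [^]\<^bsub>A\<^esub> k" unfolding z_def by (rule A.nat_pow_Suc2[OF x(1)])
    then show "e \<otimes>\<^bsub>A\<^esub> z = z" using x e' by (simp add: A.m_assoc[symmetric])
    show "z = z \<otimes>\<^bsub>A\<^esub> z \<otimes>\<^bsub>A\<^esub> y" using y(3) by (simp only: z_def)
  qed
  have comm: "y \<otimes>\<^bsub>A\<^esub> x [^]\<^bsub>A\<^esub> m = x [^]\<^bsub>A\<^esub> m \<otimes>\<^bsub>A\<^esub> y" for m :: nat
    using A.group_commutes_pow[OF y(2)[symmetric] x(1) y(1)] by (rule sym)
  have yz: "y \<otimes>\<^bsub>A\<^esub> z = z \<otimes>\<^bsub>A\<^esub> y" unfolding z_def by (rule comm)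
  define f where "f = z \<otimes>\<^bsub>A\<^esub> y"
  have f: "f \<in> carrier A" "e \<otimes>\<^bsub>A\<^esub> f = f" "f \<otimes>\<^bsub>A\<^esub> e = f" "f \<otimes>\<^bsub>A\<^esub> f = f"
  proof -
    show "f \<in> carrier A" using y z by (simp add: f_def)
    show "e \<otimes>\<^bsub>A\<^esub> f = f" using y(1) z(1,2) e'(1) by (simp add: f_def A.m_assoc[symmetric])
    show "f \<otimes>\<^bsub>A\<^esub> e = f"
      unfolding f_def yz[symmetric] using y(1) z(1,3) e'(1) by (simp add: A.m_assoc)
    have "f \<otimes>\<^bsub>A\<^esub> f = z \<otimes>\<^bsub>A\<^esub> (y \<otimes>\<^bsub>A\<^esub> z) \<otimes>\<^bsub>A\<^esub> y"
      using y(1) z(1) by (simp add: f_def A.m_assoc)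
    also have "\<dots> = (z \<otimes>\<^bsub>A\<^esub> z \<otimes>\<^bsub>A\<^esub> y) \<otimes>\<^bsub>A\<^esub> y"
      unfolding yz using y(1) z(1) by (simp add: A.m_assoc)
    also have "\<dots> = f" by (simp only: z(4)[symmetric] f_def)
    finally show "f \<otimes>\<^bsub>A\<^esub> f = f" .
  qed
  show ?thesis
  proof (cases "f = \<zero>\<^bsub>A\<^esub>")
    case True
    have "z = z \<otimes>\<^bsub>A\<^esub> f" using z(1,4) y(1) by (simp add: f_def A.m_assoc)
    then have "z = \<zero>\<^bsub>A\<^esub>" using True z(1) by simp
    then show ?thesis unfolding z_def by blast
  next
    case False
    then have "f = e" using A.primitive_idempotent_corner[OF e f(1,4,2,3)] by blast
    moreover have "f = (y \<otimes>\<^bsub>A\<^esub> x [^]\<^bsub>A\<^esub> k) \<otimes>\<^bsub>A\<^esub> x"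
      unfolding f_def yz[symmetric] using x(1) y(1) by (simp add: z_def A.m_assoc)
    ultimately show ?thesis using x(1) y(1) by auto
  qed
qed

text \<open>If every multiple of \<open>x\<close> were nilpotent, \<open>A x\<close> would be a nil left ideal.  Hence some
  \<open>f r x\<close> is invertible in the local corner at \<open>f\<close>, and the one-sided inverse of \<open>x\<close> obtained
  from it is two-sided because \<open>x y\<close> is a non-zero idempotent of the corner at \<open>e\<close>.\<close>
lemma off_radical_invertible:
  assumes e: "primitive_idempotent A e" and f: "primitive_idempotent A f"
    and x: "x \<in> carrier A" "e \<otimes>\<^bsub>A\<^esub> x = x" "x \<otimes>\<^bsub>A\<^esub> f = x" "x \<notin> jacobson_radical A"
  obtains y where "y \<in> carrier A" "f \<otimes>\<^bsub>A\<^esub> y = y" "y \<otimes>\<^bsub>A\<^esub> e = y"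
    "x \<otimes>\<^bsub>A\<^esub> y = e" "y \<otimes>\<^bsub>A\<^esub> x = f"
proof -
  note e' = A.primitive_idempotentD[OF e] and f' = A.primitive_idempotentD[OF f]
  obtain r where r: "r \<in> carrier A" "\<And>m::nat. (r \<otimes>\<^bsub>A\<^esub> x) [^]\<^bsub>A\<^esub> m \<noteq> \<zero>\<^bsub>A\<^esub>"
    using A.nil_left_ideal_in_jacobson_radical[OF x(1)] x(4) by blast
  define z where "z = f \<otimes>\<^bsub>A\<^esub> r \<otimes>\<^bsub>A\<^esub> x"
  have z: "z \<in> carrier A" "f \<otimes>\<^bsub>A\<^esub> z = z" "z \<otimes>\<^bsub>A\<^esub> f = z"
    using x r f' by (simp_all add: z_def A.m_assoc[symmetric], simp_all add: A.m_assoc)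
  \<comment> \<open>Since \<open>x = x f\<close>, every further factor \<open>r x\<close> may be replaced by \<open>z = f r x\<close>; so \<open>z\<close> is not
    nilpotent either.\<close>
  have rx: "(r \<otimes>\<^bsub>A\<^esub> x) [^]\<^bsub>A\<^esub> Suc m = (r \<otimes>\<^bsub>A\<^esub> x) \<otimes>\<^bsub>A\<^esub> z [^]\<^bsub>A\<^esub> m" for m
  proof (induction m)
    case (Suc m)
    define p where "p = (r \<otimes>\<^bsub>A\<^esub> x) \<otimes>\<^bsub>A\<^esub> z [^]\<^bsub>A\<^esub> m"
    have p: "p \<in> carrier A" using r(1) x(1) z(1) by (simp add: p_def)
    have pf: "p \<otimes>\<^bsub>A\<^esub> f = p"
    proof (cases m)
      case 0
      then show ?thesis using r(1) x(1,3) f'(1) by (simp add: p_def A.m_assoc)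
    next
      case (Suc l)
      have "z [^]\<^bsub>A\<^esub> m \<otimes>\<^bsub>A\<^esub> f = z [^]\<^bsub>A\<^esub> m"
        using z(1,3) f'(1) by (simp add: Suc A.m_assoc)
      then show ?thesis using r(1) x(1) z(1) f'(1) by (simp add: p_def A.m_assoc)
    qed
    have "(r \<otimes>\<^bsub>A\<^esub> x) [^]\<^bsub>A\<^esub> Suc (Suc m) = p \<otimes>\<^bsub>A\<^esub> f \<otimes>\<^bsub>A\<^esub> (r \<otimes>\<^bsub>A\<^esub> x)"
      unfolding pf unfolding p_def Suc[symmetric] by (rule A.nat_pow_Suc)
    also have "\<dots> = p \<otimes>\<^bsub>A\<^esub> z"
      using p r(1) x(1) f'(1) by (simp add: z_def A.m_assoc)
    also have "\<dots> = (r \<otimes>\<^bsub>A\<^esub> x) \<otimes>\<^bsub>A\<^esub> z [^]\<^bsub>A\<^esub> Suc m"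
      using r(1) x(1) z(1) by (simp add: p_def A.m_assoc)
    finally show ?case .
  qed (use r x in simp)
  have "z [^]\<^bsub>A\<^esub> m \<noteq> \<zero>\<^bsub>A\<^esub>" for m :: nat
    using rx[of m] r x(1) by (metis A.m_closed A.r_null)
  then obtain w where w: "w \<in> carrier A" "w \<otimes>\<^bsub>A\<^esub> z = f"
    using corner_nilpotent_or_unit[OF f z] by blast
  define y where "y = f \<otimes>\<^bsub>A\<^esub> (w \<otimes>\<^bsub>A\<^esub> f \<otimes>\<^bsub>A\<^esub> r) \<otimes>\<^bsub>A\<^esub> e"
  have y: "y \<in> carrier A" "f \<otimes>\<^bsub>A\<^esub> y = y" "y \<otimes>\<^bsub>A\<^esub> e = y"
    using w(1) r(1) e'(1,2) f'(1,2)
    by (simp_all add: y_def A.m_assoc[symmetric]) (simp add: A.m_assoc)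
  have "y \<otimes>\<^bsub>A\<^esub> x = f \<otimes>\<^bsub>A\<^esub> (w \<otimes>\<^bsub>A\<^esub> z)"
    using w(1) r(1) e'(1) f'(1) x(1,2) by (simp add: y_def z_def A.m_assoc)
  then have yx: "y \<otimes>\<^bsub>A\<^esub> x = f" using w(2) f'(2) by simp
  have "x \<otimes>\<^bsub>A\<^esub> y = e"
  proof (rule A.primitive_idempotent_corner[OF e])
    have "x \<otimes>\<^bsub>A\<^esub> y \<otimes>\<^bsub>A\<^esub> (x \<otimes>\<^bsub>A\<^esub> y) = x \<otimes>\<^bsub>A\<^esub> (y \<otimes>\<^bsub>A\<^esub> x) \<otimes>\<^bsub>A\<^esub> y"
      using x(1) y(1) by (simp add: A.m_assoc)
    then show "x \<otimes>\<^bsub>A\<^esub> y \<otimes>\<^bsub>A\<^esub> (x \<otimes>\<^bsub>A\<^esub> y) = x \<otimes>\<^bsub>A\<^esub> y" using yx x(3) by simp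
    show "x \<otimes>\<^bsub>A\<^esub> y \<noteq> \<zero>\<^bsub>A\<^esub>"
    proof
      assume 0: "x \<otimes>\<^bsub>A\<^esub> y = \<zero>\<^bsub>A\<^esub>"
      have "f = f \<otimes>\<^bsub>A\<^esub> f" using f'(2) by simp
      also have "\<dots> = y \<otimes>\<^bsub>A\<^esub> x \<otimes>\<^bsub>A\<^esub> (y \<otimes>\<^bsub>A\<^esub> x)" using yx by simp
      also have "\<dots> = y \<otimes>\<^bsub>A\<^esub> (x \<otimes>\<^bsub>A\<^esub> y) \<otimes>\<^bsub>A\<^esub> x" using x(1) y(1) by (simp add: A.m_assoc)
      also have "\<dots> = \<zero>\<^bsub>A\<^esub>" using 0 x(1) y(1) by simp
      finally show False using f'(3) by simp
    qed
  qed (use x y e'(1) in \<open>simp_all add: A.m_assoc, simp_all add: A.m_assoc[symmetric]\<close>)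
  then show thesis using that y yx by blast
qed

end

section \<open>Quotients of groups with operators\<close>

text \<open>Abelian groups with additive operators: a common framework for the left modules over the
  algebra and for the left vector spaces over \<open>D\<^sub>j\<close>, whose scalars are cosets.\<close>
locale operator_group = abelian_group M
  for R :: "('r, 'c) ring_scheme" and M :: "('r, 'b, 'm) module_scheme" (structure) +
  assumes operator_closed: "\<lbrakk>r \<in> carrier R; x \<in> carrier M\<rbrakk> \<Longrightarrow> r \<odot> x \<in> carrier M"
    and operator_distr: "\<lbrakk>r \<in> carrier R; x \<in> carrier M; y \<in> carrier M\<rbrakk> \<Longrightarrow>
      r \<odot> (x \<oplus> y) = r \<odot> x \<oplus> r \<odot> y"

lemma quot_module_simps:
  "carrier (quot_module M N) = a_rcosets\<^bsub>M\<^esub> N" "add (quot_module M N) = set_add M"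
  "ring.zero (quot_module M N) = N"
  "smult (quot_module M N) = (\<lambda>r C. (\<Union>x\<in>C. N +>\<^bsub>M\<^esub> (r \<odot>\<^bsub>M\<^esub> x)))"
  by (simp_all add: quot_module_def)

context operator_group
begin

lemma submodule_abelian_subgroup:
  assumes "submodule N R M"
  shows "abelian_subgroup N M"
  by (rule abelian_subgroupI3[OF additive_subgroupI[OF submodule.axioms(1)[OF assms]] abelian_group_axioms])

lemma coset_eq_iff:
  assumes "submodule N R M" "x \<in> carrier M" "y \<in> carrier M"
  shows "N +> x = N +> y \<longleftrightarrow> x \<oplus> \<ominus> y \<in> N"
proof -
  interpret N: abelian_subgroup N M by (rule submodule_abelian_subgroup[OF assms(1)])
  show ?thesis
    using N.a_rcos_module[OF assms(3,2)] N.a_repr_independence'[OF _ assms(3)] N.a_rcos_self[OF assms(2)]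
    by metis
qed

lemma quot_carrierE:
  assumes "C \<in> carrier (quot_module M N)"
  obtains x where "x \<in> carrier M" "C = N +> x"
  using assms by (auto simp: quot_module_simps A_RCOSETS_def')

lemma quot_carrierI: "x \<in> carrier M \<Longrightarrow> N +> x \<in> carrier (quot_module M N)"
  by (auto simp: quot_module_simps A_RCOSETS_def')

lemma quot_add:
  assumes "submodule N R M" "x \<in> carrier M" "y \<in> carrier M"
  shows "(N +> x) \<oplus>\<^bsub>quot_module M N\<^esub> (N +> y) = N +> (x \<oplus> y)"
  using abelian_subgroup.a_rcos_sum[OF submodule_abelian_subgroup[OF assms(1)] assms(2,3)]
  by (simp add: quot_module_simps)

lemma operator_minus:
  assumes "r \<in> carrier R" "x \<in> carrier M"
  shows "r \<odot> (\<ominus> x) = \<ominus> (r \<odot> x)"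
proof -
  have z: "r \<odot> \<zero> = \<zero>"
    using operator_distr[OF assms(1) zero_closed zero_closed] operator_closed[OF assms(1) zero_closed]
    by (simp add: add.l_cancel_one')
  have "r \<odot> (\<ominus> x) \<oplus> r \<odot> x = \<zero>"
    using operator_distr[of r "\<ominus> x" x] assms z by (simp add: l_neg)
  then show ?thesis using operator_closed assms by (simp add: minus_equality)
qed

text \<open>The scalar action on a coset is a union over its representatives, which all contribute the
  same coset.\<close>
lemma quot_smult:
  assumes N: "submodule N R M" and r: "r \<in> carrier R" and x: "x \<in> carrier M"
  shows "r \<odot>\<^bsub>quot_module M N\<^esub> (N +> x) = N +> (r \<odot> x)"
proof -
  interpret N: abelian_subgroup N M by (rule submodule_abelian_subgroup[OF N])
  have "N +> (r \<odot> y) = N +> (r \<odot> x)" if y: "y \<in> N +> x" for y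
  proof -
    have yc: "y \<in> carrier M" by (rule N.a_elemrcos_carrier[OF x y])
    have "y \<oplus> \<ominus> x \<in> N" using N.a_rcos_module[OF x yc] y by simp
    then have "r \<odot> (y \<oplus> \<ominus> x) \<in> N" by (rule submodule.smult_closed[OF N r])
    then have "r \<odot> y \<oplus> \<ominus> (r \<odot> x) \<in> N"
      using operator_distr[OF r yc, of "\<ominus> x"] operator_minus[OF r x] x by simp
    then show ?thesis using coset_eq_iff[OF N] operator_closed r x yc by simp
  qed
  moreover have "x \<in> N +> x" by (rule N.a_rcos_self[OF x])
  ultimately show ?thesis unfolding quot_module_simps by blast
qed

lemma quot_operator_group:
  assumes N: "submodule N R M"
  shows "operator_group R (quot_module M N)"
proof -
  interpret N: abelian_subgroup N M by (rule submodule_abelian_subgroup[OF N])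
  have comm: "set_add M C D = set_add M D C" if CD: "C \<in> a_rcosets N" "D \<in> a_rcosets N" for C D
  proof -
    obtain x y where "x \<in> carrier M" "C = N +> x" "y \<in> carrier M" "D = N +> y"
      using CD unfolding A_RCOSETS_def' by blast
    then show ?thesis by (simp add: N.a_rcos_sum a_comm)
  qed
  have ab: "abelian_group (quot_module M N)"
  proof (rule abelian_groupI, unfold quot_module_simps)
    fix C assume C: "C \<in> a_rcosets N"
    show "set_add M N C = C" using C by (rule N.rcosets_add_eq)
    show "\<exists>D\<in>a_rcosets N. set_add M D C = N"
      using N.a_setinv_closed[OF C] N.a_rcosets_inv_mult_group_eq[OF C] by blast
  qed (rule N.a_setmult_closed N.a_subgroup_in_rcosets N.a_rcosets_assoc comm; assumption)+
  show ?thesis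
  proof (intro operator_group.intro ab operator_group_axioms.intro)
    fix r C assume r: "r \<in> carrier R" and C: "C \<in> carrier (quot_module M N)"
    obtain x where x: "x \<in> carrier M" "C = N +> x" using C by (rule quot_carrierE)
    show "r \<odot>\<^bsub>quot_module M N\<^esub> C \<in> carrier (quot_module M N)"
      unfolding x(2) quot_smult[OF N r x(1)] using operator_closed[OF r x(1)] by (rule quot_carrierI)
    fix C' assume C': "C' \<in> carrier (quot_module M N)"
    obtain y where y: "y \<in> carrier M" "C' = N +> y" using C' by (rule quot_carrierE)
    show "r \<odot>\<^bsub>quot_module M N\<^esub> (C \<oplus>\<^bsub>quot_module M N\<^esub> C')
        = r \<odot>\<^bsub>quot_module M N\<^esub> C \<oplus>\<^bsub>quot_module M N\<^esub> r \<odot>\<^bsub>quot_module M N\<^esub> C'"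
      using r x(1) y(1) operator_closed[OF r]
      by (simp add: x(2) y(2) quot_add[OF N] quot_smult[OF N] operator_distr)
  qed
qed

text \<open>An automorphism carrying \<open>N\<close> to \<open>N'\<close> descends to the quotients by taking images of cosets.\<close>
lemma quot_module_iso_of_automorphism:
  assumes N: "submodule N R M" and N': "submodule N' R M"
    and surj: "f ` carrier M = carrier M"
    and add: "\<And>x y. \<lbrakk>x \<in> carrier M; y \<in> carrier M\<rbrakk> \<Longrightarrow> f (x \<oplus> y) = f x \<oplus> f y"
    and smult: "\<And>r x. \<lbrakk>r \<in> carrier R; x \<in> carrier M\<rbrakk> \<Longrightarrow> f (r \<odot> x) = r \<odot> f x"
    and N_iff: "\<And>x. x \<in> carrier M \<Longrightarrow> f x \<in> N' \<longleftrightarrow> x \<in> N"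
  shows "module_iso R (quot_module M N) (quot_module M N')"
proof -
  interpret N: abelian_subgroup N M by (rule submodule_abelian_subgroup[OF N])
  interpret N': abelian_subgroup N' M by (rule submodule_abelian_subgroup[OF N'])
  have fc: "f x \<in> carrier M" if "x \<in> carrier M" for x using surj that by blast
  have fN: "f ` N = N'"
  proof
    show "f ` N \<subseteq> N'" using N_iff N.a_subset by blast
    show "N' \<subseteq> f ` N"
    proof
      fix y assume y: "y \<in> N'"
      then have "y \<in> f ` carrier M" unfolding surj by (rule N'.a_Hcarr)
      then obtain x where "x \<in> carrier M" "y = f x" by blast
      then show "y \<in> f ` N" using N_iff y by blast
    qed
  qed
  have img: "f ` (N +> x) = N' +> f x" if x: "x \<in> carrier M" for x
  proof -
    have "f (h \<oplus> x) = f h \<oplus> f x" if "h \<in> N" for h by (rule add[OF N.a_Hcarr[OF that] x])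
    then have "f ` (N +> x) = (\<Union>h\<in>N. {f h \<oplus> f x})" unfolding a_r_coset_def' by (simp add: image_UN)
    also have "\<dots> = (\<Union>h\<in>f ` N. {h \<oplus> f x})" by blast
    finally show ?thesis unfolding fN a_r_coset_def' .
  qed
  have minus: "f (\<ominus> x) = \<ominus> f x" if x: "x \<in> carrier M" for x
  proof -
    have "f \<zero> \<oplus> f \<zero> = f \<zero>" using add[OF zero_closed zero_closed] by simp
    then have "f \<zero> = \<zero>" using fc[OF zero_closed] by (simp add: add.l_cancel_one')
    then have "f (\<ominus> x) \<oplus> f x = \<zero>" using add[of "\<ominus> x" x] x by (simp add: l_neg)
    then show ?thesis using fc x by (simp add: minus_equality)
  qed
  have eq_iff: "N' +> f x = N' +> f y \<longleftrightarrow> N +> x = N +> y"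
    if "x \<in> carrier M" "y \<in> carrier M" for x y
    unfolding coset_eq_iff[OF N that] coset_eq_iff[OF N' fc fc, OF that]
      N_iff[OF a_closed[OF that(1) a_inv_closed[OF that(2)]], symmetric]
      add[OF that(1) a_inv_closed[OF that(2)]] minus[OF that(2)] by (rule refl)
  have "(\<lambda>C. f ` C) \<in> iso (add_monoid (quot_module M N)) (add_monoid (quot_module M N'))"
  proof (rule isoI)
    show "(\<lambda>C. f ` C) \<in> hom (add_monoid (quot_module M N)) (add_monoid (quot_module M N'))"
    proof (rule homI)
      fix C assume "C \<in> carrier (add_monoid (quot_module M N))"
      then obtain x where x: "x \<in> carrier M" "C = N +> x" by (auto elim: quot_carrierE)
      show "f ` C \<in> carrier (add_monoid (quot_module M N'))"
        using quot_carrierI[OF fc[OF x(1)], of N'] by (simp add: img x)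
      fix C' assume "C' \<in> carrier (add_monoid (quot_module M N))"
      then obtain y where y: "y \<in> carrier M" "C' = N +> y" by (auto elim: quot_carrierE)
      show "f ` (C \<otimes>\<^bsub>add_monoid (quot_module M N)\<^esub> C')
          = f ` C \<otimes>\<^bsub>add_monoid (quot_module M N')\<^esub> f ` C'"
        using x y fc by (simp add: quot_add[OF N] quot_add[OF N'] img add)
    qed
    have "inj_on (\<lambda>C. f ` C) (carrier (quot_module M N))"
    proof (rule inj_onI)
      fix C C' assume C: "C \<in> carrier (quot_module M N)" and C': "C' \<in> carrier (quot_module M N)"
        and eq: "f ` C = f ` C'"
      obtain x where x: "x \<in> carrier M" "C = N +> x" using C by (rule quot_carrierE)
      obtain y where y: "y \<in> carrier M" "C' = N +> y" using C' by (rule quot_carrierE)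
      show "C = C'" using eq eq_iff[OF x(1) y(1)] by (simp add: x y img)
    qed
    moreover have "(\<lambda>C. f ` C) ` carrier (quot_module M N) = carrier (quot_module M N')"
    proof -
      have "(\<lambda>C. f ` C) ` carrier (quot_module M N) = (\<lambda>x. f ` (N +> x)) ` carrier M"
        unfolding quot_module_simps A_RCOSETS_def' by blast
      also have "\<dots> = (\<lambda>x. N' +> x) ` (f ` carrier M)"
        unfolding image_image using img by (rule image_cong[OF refl])
      also have "\<dots> = carrier (quot_module M N')"
        unfolding surj quot_module_simps A_RCOSETS_def' by blast
      finally show ?thesis .
    qed
    ultimately show "bij_betw (\<lambda>C. f ` C) (carrier (add_monoid (quot_module M N)))
        (carrier (add_monoid (quot_module M N')))"
      by (simp add: bij_betw_def)
  qed
  moreover have "f ` (r \<odot>\<^bsub>quot_module M N\<^esub> C) = r \<odot>\<^bsub>quot_module M N'\<^esub> f ` C"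
    if r: "r \<in> carrier R" and C: "C \<in> carrier (quot_module M N)" for r C
  proof -
    obtain x where x: "x \<in> carrier M" "C = N +> x" using C by (rule quot_carrierE)
    show ?thesis
      using x(1) fc[OF x(1)] operator_closed[OF r x(1)] r
      by (simp add: x(2) quot_smult[OF N r] quot_smult[OF N' r] img smult)
  qed
  ultimately show ?thesis unfolding module_iso_def by blast
qed

end

lemma module_isoE:
  assumes "module_iso R M N"
  obtains f where "bij_betw f (carrier M) (carrier N)"
    and "\<And>x y. x \<in> carrier M \<Longrightarrow> y \<in> carrier M \<Longrightarrow> f (x \<oplus>\<^bsub>M\<^esub> y) = f x \<oplus>\<^bsub>N\<^esub> f y"
    and "\<And>r x. r \<in> carrier R \<Longrightarrow> x \<in> carrier M \<Longrightarrow> f (r \<odot>\<^bsub>M\<^esub> x) = r \<odot>\<^bsub>N\<^esub> f x"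
  using assms by (auto simp: module_iso_def iso_def hom_def)

lemma module_isoI:
  assumes "bij_betw f (carrier M) (carrier N)"
    and "\<And>x y. x \<in> carrier M \<Longrightarrow> y \<in> carrier M \<Longrightarrow> f (x \<oplus>\<^bsub>M\<^esub> y) = f x \<oplus>\<^bsub>N\<^esub> f y"
    and "\<And>r x. r \<in> carrier R \<Longrightarrow> x \<in> carrier M \<Longrightarrow> f (r \<odot>\<^bsub>M\<^esub> x) = r \<odot>\<^bsub>N\<^esub> f x"
  shows "module_iso R M N"
  unfolding module_iso_def using assms
  by (intro bexI[of _ f] isoI homI) (auto simp: bij_betw_apply)

lemma module_iso_sym:
  assumes M: "operator_group R M" and iso: "module_iso R M N"
  shows "module_iso R N M"
proof -
  interpret operator_group R M by fact
  obtain f where f: "bij_betw f (carrier M) (carrier N)"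
    "\<And>x y. x \<in> carrier M \<Longrightarrow> y \<in> carrier M \<Longrightarrow> f (x \<oplus>\<^bsub>M\<^esub> y) = f x \<oplus>\<^bsub>N\<^esub> f y"
    "\<And>r x. r \<in> carrier R \<Longrightarrow> x \<in> carrier M \<Longrightarrow> f (r \<odot>\<^bsub>M\<^esub> x) = r \<odot>\<^bsub>N\<^esub> f x"
    using iso by (rule module_isoE) blast
  define g where "g = inv_into (carrier M) f"
  have g: "g y \<in> carrier M" "f (g y) = y" if "y \<in> carrier N" for y
    using that f(1) bij_betw_inv_into_right[OF f(1)] by (auto simp: g_def bij_betw_def inv_into_into)
  have gf: "g (f x) = x" if "x \<in> carrier M" for x
    using that bij_betw_inv_into_left[OF f(1)] by (simp add: g_def)
  show ?thesis
  proof (rule module_isoI[of g])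
    show "bij_betw g (carrier N) (carrier M)"
      unfolding g_def by (rule bij_betw_inv_into[OF f(1)])
    fix x y assume x: "x \<in> carrier N" and y: "y \<in> carrier N"
    have "f (g x \<oplus>\<^bsub>M\<^esub> g y) = x \<oplus>\<^bsub>N\<^esub> y" using f(2) g x y by simp
    then show "g (x \<oplus>\<^bsub>N\<^esub> y) = g x \<oplus>\<^bsub>M\<^esub> g y" using gf[of "g x \<oplus>\<^bsub>M\<^esub> g y"] g x y by simp
  next
    fix r x assume r: "r \<in> carrier R" and x: "x \<in> carrier N"
    have "f (r \<odot>\<^bsub>M\<^esub> g x) = r \<odot>\<^bsub>N\<^esub> x" using f(3) g r x by simp
    then show "g (r \<odot>\<^bsub>N\<^esub> x) = r \<odot>\<^bsub>M\<^esub> g x"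
      using gf[of "r \<odot>\<^bsub>M\<^esub> g x"] operator_closed[OF r] g x by simp
  qed
qed

lemma module_basis_independent:
  assumes "module_basis R M B" "c \<in> B \<rightarrow> carrier R"
    "(\<Oplus>\<^bsub>M\<^esub>b\<in>B. c b \<odot>\<^bsub>M\<^esub> b) = \<zero>\<^bsub>M\<^esub>" "b \<in> B"
  shows "c b = \<zero>\<^bsub>R\<^esub>"
  using assms by (simp add: module_basis_def)

lemma module_basis_image_of_iso:
  assumes M: "operator_group R M" and N: "operator_group R N"
    and iso: "module_iso R M N" and B: "module_basis R M B"
  shows "\<exists>B'. module_basis R N B' \<and> card B' = card B"
proof -
  interpret M: operator_group R M by fact
  interpret N: operator_group R N by fact
  obtain f where f: "bij_betw f (carrier M) (carrier N)"
    "\<And>x y. x \<in> carrier M \<Longrightarrow> y \<in> carrier M \<Longrightarrow> f (x \<oplus>\<^bsub>M\<^esub> y) = f x \<oplus>\<^bsub>N\<^esub> f y"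
    "\<And>r x. r \<in> carrier R \<Longrightarrow> x \<in> carrier M \<Longrightarrow> f (r \<odot>\<^bsub>M\<^esub> x) = r \<odot>\<^bsub>N\<^esub> f x"
    using iso by (rule module_isoE) blast
  have fc: "f x \<in> carrier N" if "x \<in> carrier M" for x using f(1) that by (rule bij_betw_apply)
  have B': "finite B" "B \<subseteq> carrier M" using B by (auto simp: module_basis_def)
  have inj: "inj_on f B" using f(1) B'(2) by (auto simp: bij_betw_def intro: inj_on_subset)
  have f0: "f \<zero>\<^bsub>M\<^esub> = \<zero>\<^bsub>N\<^esub>"
    using f(2)[of "\<zero>\<^bsub>M\<^esub>" "\<zero>\<^bsub>M\<^esub>"] fc[of "\<zero>\<^bsub>M\<^esub>"] by (simp add: N.add.l_cancel_one')
  have f_finsum: "f (\<Oplus>\<^bsub>M\<^esub>b\<in>C. g b) = (\<Oplus>\<^bsub>N\<^esub>b\<in>C. f (g b))"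
    if "finite C" "g \<in> C \<rightarrow> carrier M" for g and C :: "'c set"
    using that
  proof (induction C rule: finite_induct)
    case (insert b C)
    then have g: "g \<in> C \<rightarrow> carrier M" "g b \<in> carrier M" by auto
    moreover have "(\<lambda>b. f (g b)) \<in> C \<rightarrow> carrier N" using fc g(1) by auto
    ultimately show ?case
      using insert.hyps insert.IH fc
      by (simp add: M.finsum_insert N.finsum_insert f(2) M.finsum_closed)
  qed (simp add: f0)
  have sum: "f (\<Oplus>\<^bsub>M\<^esub>b\<in>B. c (f b) \<odot>\<^bsub>M\<^esub> b) = (\<Oplus>\<^bsub>N\<^esub>b\<in>f ` B. c b \<odot>\<^bsub>N\<^esub> b)"
    if c: "\<And>b. b \<in> B \<Longrightarrow> c (f b) \<in> carrier R" for c
  proof -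
    have carr: "c (f b) \<odot>\<^bsub>N\<^esub> f b \<in> carrier N" "c (f b) \<odot>\<^bsub>M\<^esub> b \<in> carrier M" if "b \<in> B" for b
      using N.operator_closed M.operator_closed c that B'(2) fc by blast+
    have "f (\<Oplus>\<^bsub>M\<^esub>b\<in>B. c (f b) \<odot>\<^bsub>M\<^esub> b) = (\<Oplus>\<^bsub>N\<^esub>b\<in>B. f (c (f b) \<odot>\<^bsub>M\<^esub> b))"
      using carr by (intro f_finsum B'(1)) auto
    also have "\<dots> = (\<Oplus>\<^bsub>N\<^esub>b\<in>B. c (f b) \<odot>\<^bsub>N\<^esub> f b)"
      using carr c B'(2) f(3) by (intro N.finsum_cong' refl) auto
    also have "\<dots> = (\<Oplus>\<^bsub>N\<^esub>b\<in>f ` B. c b \<odot>\<^bsub>N\<^esub> b)"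
      using carr inj by (intro N.finsum_reindex[symmetric]) auto
    finally show ?thesis .
  qed
  have "module_basis R N (f ` B)"
    unfolding module_basis_def
  proof (intro conjI ballI impI)
    show "finite (f ` B)" "f ` B \<subseteq> carrier N" using B' fc by auto
  next
    fix y assume "y \<in> carrier N"
    then obtain x where x: "x \<in> carrier M" "y = f x" using f(1) by (auto simp: bij_betw_def)
    obtain c where c: "c \<in> B \<rightarrow> carrier R" "x = (\<Oplus>\<^bsub>M\<^esub>b\<in>B. c b \<odot>\<^bsub>M\<^esub> b)"
      using B x(1) unfolding module_basis_def by blast
    define d where "d = (\<lambda>b. c (inv_into B f b))"
    have d: "d (f b) = c b" if "b \<in> B" for b using inj that by (simp add: d_def)
    have "(\<Oplus>\<^bsub>M\<^esub>b\<in>B. c b \<odot>\<^bsub>M\<^esub> b) = (\<Oplus>\<^bsub>M\<^esub>b\<in>B. d (f b) \<odot>\<^bsub>M\<^esub> b)"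
      using M.operator_closed[OF funcset_mem[OF c(1)] subsetD[OF B'(2)]]
      by (intro M.finsum_cong' refl) (auto simp: d)
    then have "y = (\<Oplus>\<^bsub>N\<^esub>b\<in>f ` B. d b \<odot>\<^bsub>N\<^esub> b)"
      using sum[of d] x(2) c d by auto
    moreover have "d \<in> f ` B \<rightarrow> carrier R" using c(1) d by auto
    ultimately show "\<exists>c\<in>f ` B \<rightarrow> carrier R. y = (\<Oplus>\<^bsub>N\<^esub>b\<in>f ` B. c b \<odot>\<^bsub>N\<^esub> b)" by blast
  next
    fix c b' assume c: "c \<in> f ` B \<rightarrow> carrier R"
      and 0: "(\<Oplus>\<^bsub>N\<^esub>b\<in>f ` B. c b \<odot>\<^bsub>N\<^esub> b) = \<zero>\<^bsub>N\<^esub>" and "b' \<in> f ` B"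
    then obtain b where b: "b \<in> B" "b' = f b" by blast
    have cf: "(\<lambda>b. c (f b)) \<in> B \<rightarrow> carrier R" using c by auto
    have cl: "(\<Oplus>\<^bsub>M\<^esub>b\<in>B. c (f b) \<odot>\<^bsub>M\<^esub> b) \<in> carrier M"
      using M.operator_closed[OF funcset_mem[OF cf] subsetD[OF B'(2)]]
      by (intro M.finsum_closed) auto
    have "f (\<Oplus>\<^bsub>M\<^esub>b\<in>B. c (f b) \<odot>\<^bsub>M\<^esub> b) = f \<zero>\<^bsub>M\<^esub>"
      using sum[of c] cf 0 f0 by auto
    then have "(\<Oplus>\<^bsub>M\<^esub>b\<in>B. c (f b) \<odot>\<^bsub>M\<^esub> b) = \<zero>\<^bsub>M\<^esub>"
      using f(1) cl by (auto simp: bij_betw_def dest: inj_onD)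
    then show "c b' = \<zero>\<^bsub>R\<^esub>"
      using module_basis_independent[OF B cf] b by simp
  qed
  then show ?thesis using card_image[OF inj] by blast
qed

text \<open>A dimension is the cardinality of a basis, and isomorphic modules have bases of the same
  cardinalities; invariance holds even where that cardinality is not unique.\<close>
lemma module_dim_cong_iso:
  assumes "operator_group R M" "operator_group R N" "module_iso R M N"
  shows "module_dim R M = module_dim R N"
proof -
  have "(\<exists>B. module_basis R M B \<and> card B = d) \<longleftrightarrow> (\<exists>B. module_basis R N B \<and> card B = d)" for d
    using module_basis_image_of_iso[OF assms]
      module_basis_image_of_iso[OF assms(2,1) module_iso_sym[OF assms(1,3)]] by metis
  then show ?thesis unfolding module_dim_def by presburger
qed

text \<open>The only basis of the zero module is empty: a basis element \<open>0\<close> would be annihilated by the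
  scalar \<open>1\<close>.\<close>
lemma module_dim_zero:
  assumes M: "operator_group R M" and R: "\<one>\<^bsub>R\<^esub> \<in> carrier R" "\<one>\<^bsub>R\<^esub> \<noteq> \<zero>\<^bsub>R\<^esub>"
    and zero: "carrier M = {\<zero>\<^bsub>M\<^esub>}"
  shows "module_dim R M = 0"
proof -
  interpret M: operator_group R M by fact
  have "module_basis R M B \<longleftrightarrow> B = {}" for B
  proof
    assume B: "module_basis R M B"
    show "B = {}"
    proof (rule ccontr)
      assume "B \<noteq> {}"
      then have eq: "B = {\<zero>\<^bsub>M\<^esub>}" using B zero by (auto simp: module_basis_def)
      have "(\<Oplus>\<^bsub>M\<^esub>b\<in>B. \<one>\<^bsub>R\<^esub> \<odot>\<^bsub>M\<^esub> b) \<in> carrier M"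
        using eq M.operator_closed[OF R(1) M.zero_closed] by (intro M.finsum_closed) auto
      then have "(\<Oplus>\<^bsub>M\<^esub>b\<in>B. \<one>\<^bsub>R\<^esub> \<odot>\<^bsub>M\<^esub> b) = \<zero>\<^bsub>M\<^esub>" using zero by simp
      moreover have "(\<lambda>_. \<one>\<^bsub>R\<^esub>) \<in> B \<rightarrow> carrier R" using R(1) by simp
      ultimately show False using module_basis_independent[OF B, of "\<lambda>_. \<one>\<^bsub>R\<^esub>"] R(2) eq by simp
    qed
  next
    assume "B = {}"
    then show "module_basis R M B" using zero by (simp add: module_basis_def)
  qed
  then have "(\<exists>B. module_basis R M B \<and> card B = d) \<longleftrightarrow> d = 0" for d by auto
  then show ?thesis unfolding module_dim_def by simp
qed

section \<open>Corner rings and their residue algebras\<close>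

context ring
begin

lemma peirce_ideal_iff:
  assumes "ideal I R" "p \<in> carrier R" "p \<otimes> p = p" "q \<in> carrier R" "q \<otimes> q = q"
  shows "x \<in> peirce R p I q \<longleftrightarrow> x \<in> I \<and> p \<otimes> x = x \<and> x \<otimes> q = x"
proof -
  interpret I: ideal I R by fact
  have fwd: "p \<otimes> a \<otimes> q \<in> I \<and> p \<otimes> (p \<otimes> a \<otimes> q) = p \<otimes> a \<otimes> q \<and> p \<otimes> a \<otimes> q \<otimes> q = p \<otimes> a \<otimes> q"
    if "a \<in> I" for a
  proof (intro conjI)
    have a: "a \<in> carrier R" using that by (rule I.Icarr)
    show "p \<otimes> a \<otimes> q \<in> I" by (intro I.I_r_closed I.I_l_closed that assms)
    show "p \<otimes> (p \<otimes> a \<otimes> q) = p \<otimes> a \<otimes> q"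
      using a assms by (simp add: m_assoc[symmetric])
    show "p \<otimes> a \<otimes> q \<otimes> q = p \<otimes> a \<otimes> q"
      using a assms by (simp add: m_assoc)
  qed
  show ?thesis
  proof
    assume "x \<in> peirce R p I q"
    then obtain a where "a \<in> I" "x = p \<otimes> a \<otimes> q" unfolding peirce_def by blast
    then show "x \<in> I \<and> p \<otimes> x = x \<and> x \<otimes> q = x" using fwd by simp
  next
    assume x: "x \<in> I \<and> p \<otimes> x = x \<and> x \<otimes> q = x"
    then have "x = p \<otimes> x \<otimes> q" by simp
    then show "x \<in> peirce R p I q" unfolding peirce_def using x by (rule_tac image_eqI) auto
  qed
qed

lemma corner_carrier_iff:
  assumes "p \<in> carrier R" "p \<otimes> p = p"
  shows "x \<in> carrier (corner_ring R p) \<longleftrightarrow> x \<in> carrier R \<and> p \<otimes> x = x \<and> x \<otimes> p = x"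
  using peirce_ideal_iff[OF oneideal assms assms] by (simp add: corner_ring_def)

lemma corner_ring_simps:
  "add (corner_ring R p) = add R" "monoid.mult (corner_ring R p) = monoid.mult R"
  "ring.zero (corner_ring R p) = \<zero>" "one (corner_ring R p) = p"
  "a_r_coset (corner_ring R p) = a_r_coset R"
  by (simp_all add: corner_ring_def a_r_coset_def' fun_eq_iff)

lemma corner_minus_closed:
  assumes p: "p \<in> carrier R" "p \<otimes> p = p"
    and x: "x \<in> carrier (corner_ring R p)" and y: "y \<in> carrier (corner_ring R p)"
  shows "x \<oplus> \<ominus> y \<in> carrier (corner_ring R p)"
  using p x y unfolding corner_carrier_iff[OF p] by (simp add: l_distr r_distr l_minus r_minus)

lemma corner_ring_is_ring:
  assumes p: "p \<in> carrier R" "p \<otimes> p = p"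
  shows "ring (corner_ring R p)"
proof (rule ringI)
  note iff = corner_carrier_iff[OF p]
  show "abelian_group (corner_ring R p)"
  proof (rule abelian_groupI)
    fix x assume "x \<in> carrier (corner_ring R p)"
    then have x: "x \<in> carrier R" "p \<otimes> x = x" "x \<otimes> p = x" by (simp_all add: iff)
    then have "\<ominus> x \<in> carrier (corner_ring R p)" using p by (simp add: iff l_minus r_minus)
    moreover have "\<ominus> x \<oplus> x = \<zero>" using x by (simp add: l_neg)
    ultimately show "\<exists>y\<in>carrier (corner_ring R p).
        y \<oplus>\<^bsub>corner_ring R p\<^esub> x = \<zero>\<^bsub>corner_ring R p\<^esub>"
      by (auto simp: corner_ring_simps)
  qed (use p in \<open>auto simp: iff corner_ring_simps l_distr r_distr a_ac\<close>)
  show "Group.monoid (corner_ring R p)"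
    using p by (intro monoidI) (simp_all add: iff corner_ring_simps m_assoc, simp add: m_assoc[symmetric])
qed (simp_all add: corner_carrier_iff[OF p] corner_ring_simps l_distr r_distr)

lemma corner_a_inv:
  assumes p: "p \<in> carrier R" "p \<otimes> p = p" and x: "x \<in> carrier (corner_ring R p)"
  shows "\<ominus>\<^bsub>corner_ring R p\<^esub> x = \<ominus> x"
proof -
  interpret C: ring "corner_ring R p" by (rule corner_ring_is_ring[OF p])
  have xc: "x \<in> carrier R" using x by (simp add: corner_carrier_iff[OF p])
  have "\<ominus> x \<in> carrier (corner_ring R p)"
    using corner_minus_closed[OF p C.zero_closed x] xc by (simp add: corner_ring_simps)
  moreover have "\<ominus> x \<oplus>\<^bsub>corner_ring R p\<^esub> x = \<zero>\<^bsub>corner_ring R p\<^esub>"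
    using xc by (simp add: corner_ring_simps l_neg)
  ultimately show ?thesis using C.minus_equality x by blast
qed

lemma corner_ideal:
  assumes p: "p \<in> carrier R" "p \<otimes> p = p" and I: "ideal I R"
  shows "ideal (peirce R p I p) (corner_ring R p)"
proof (rule idealI)
  interpret I: ideal I R by fact
  interpret C: ring "corner_ring R p" by (rule corner_ring_is_ring[OF p])
  note iff = peirce_ideal_iff[OF I p p] corner_carrier_iff[OF p]
  show "ring (corner_ring R p)" by (rule C.ring_axioms)
  show "subgroup (peirce R p I p) (add_monoid (corner_ring R p))"
  proof (rule C.add.subgroupI)
    show sub: "peirce R p I p \<subseteq> carrier (corner_ring R p)"
      unfolding subset_iff iff by simp
    have "\<zero> \<in> peirce R p I p" using p by (simp add: iff)
    then show "peirce R p I p \<noteq> {}" by blast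
    show "\<ominus>\<^bsub>corner_ring R p\<^esub> x \<in> peirce R p I p" if x: "x \<in> peirce R p I p" for x
      unfolding corner_a_inv[OF p subsetD[OF sub x]]
      using x p by (simp add: iff l_minus r_minus)
  qed (use p in \<open>simp add: iff corner_ring_simps l_distr r_distr\<close>)
next
  interpret I: ideal I R by fact
  fix a x assume "a \<in> peirce R p I p" "x \<in> carrier (corner_ring R p)"
  then show "x \<otimes>\<^bsub>corner_ring R p\<^esub> a \<in> peirce R p I p" "a \<otimes>\<^bsub>corner_ring R p\<^esub> x \<in> peirce R p I p"
    using p I.I_l_closed I.I_r_closed
    by (simp_all add: peirce_ideal_iff[OF I p p] corner_carrier_iff[OF p] corner_ring_simps m_assoc)
       (simp_all add: m_assoc[symmetric])
qed

lemma division_alg_ring: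
  assumes p: "p \<in> carrier R" "p \<otimes> p = p"
  shows "ring (division_alg R p)"
  unfolding division_alg_def
  by (rule ideal.quotient_is_ring[OF corner_ideal[OF p jacobson_radical_ideal]])

text \<open>The canonical projection from the corner ring to the division algebra.\<close>
definition residue :: "'a \<Rightarrow> 'a \<Rightarrow> 'a set"
  where "residue p x = peirce R p (jacobson_radical R) p +> x"

lemma division_alg_carrier:
  "carrier (division_alg R p) = residue p ` carrier (corner_ring R p)"
  by (auto simp: division_alg_def FactRing_def A_RCOSETS_def' corner_ring_simps residue_def)

lemma division_alg_one: "\<one>\<^bsub>division_alg R p\<^esub> = residue p p"
  by (simp add: division_alg_def FactRing_def corner_ring_simps residue_def)

lemma division_alg_mult:
  assumes p: "p \<in> carrier R" "p \<otimes> p = p"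
    and "x \<in> carrier (corner_ring R p)" "y \<in> carrier (corner_ring R p)"
  shows "residue p x \<otimes>\<^bsub>division_alg R p\<^esub> residue p y = residue p (x \<otimes> y)"
  using ideal.rcoset_mult_add[OF corner_ideal[OF p jacobson_radical_ideal] assms(3,4)]
  by (simp add: division_alg_def FactRing_def corner_ring_simps residue_def)

lemma residue_eq_iff:
  assumes p: "p \<in> carrier R" "p \<otimes> p = p"
    and x: "x \<in> carrier (corner_ring R p)" and y: "y \<in> carrier (corner_ring R p)"
  shows "residue p x = residue p y \<longleftrightarrow> x \<oplus> \<ominus> y \<in> jacobson_radical R"
proof -
  interpret I: ideal "peirce R p (jacobson_radical R) p" "corner_ring R p"
    by (rule corner_ideal[OF p jacobson_radical_ideal])
  have "residue p x = residue p y \<longleftrightarrow> x \<in> peirce R p (jacobson_radical R) p +>\<^bsub>corner_ring R p\<^esub> y"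
    using I.a_repr_independence'[OF _ y] I.a_rcos_self[OF x]
    unfolding corner_ring_simps residue_def by metis
  also have "\<dots> \<longleftrightarrow> x \<oplus> \<ominus> y \<in> peirce R p (jacobson_radical R) p"
    using I.a_rcos_module[OF y x] by (simp only: corner_a_inv[OF p y] corner_ring_simps)
  also have "\<dots> \<longleftrightarrow> x \<oplus> \<ominus> y \<in> jacobson_radical R"
    using corner_minus_closed[OF p x y]
    by (simp add: peirce_ideal_iff[OF jacobson_radical_ideal p p] corner_carrier_iff[OF p])
  finally show ?thesis .
qed

lemma in_residueE:
  assumes p: "p \<in> carrier R" "p \<otimes> p = p" and "y \<in> residue p x"
  obtains z where "z \<in> jacobson_radical R" "p \<otimes> z = z" "z \<otimes> p = z" "y = z \<oplus> x"
  using assms(3) peirce_ideal_iff[OF jacobson_radical_ideal p p]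
  unfolding residue_def a_r_coset_def' by auto

lemma in_residue_self:
  assumes p: "p \<in> carrier R" "p \<otimes> p = p" and x: "x \<in> carrier R"
  shows "x \<in> residue p x"
proof -
  have "\<zero> \<in> peirce R p (jacobson_radical R) p"
    using p ideal.axioms(1)[OF jacobson_radical_ideal]
    by (simp add: peirce_ideal_iff[OF jacobson_radical_ideal p p] additive_subgroup.zero_closed)
  then show ?thesis using x unfolding residue_def a_r_coset_def' by force
qed

section \<open>Modules carried by additive subgroups\<close>

lemma mk_module_abelian_group:
  assumes "additive_subgroup S R"
  shows "abelian_group (mk_module S (add R) \<zero> sm)"
proof -
  interpret S: additive_subgroup S R by fact
  show ?thesis
  proof (rule abelian_groupI)
    fix x assume "x \<in> carrier (mk_module S (add R) \<zero> sm)"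
    then show "\<exists>y\<in>carrier (mk_module S (add R) \<zero> sm).
        y \<oplus>\<^bsub>mk_module S (add R) \<zero> sm\<^esub> x = \<zero>\<^bsub>mk_module S (add R) \<zero> sm\<^esub>"
      by (intro bexI[of _ "\<ominus> x"]) (simp_all add: l_neg)
  qed (simp_all add: a_assoc, simp add: a_comm)
qed

lemma mk_module_a_inv:
  assumes "additive_subgroup S R" "x \<in> S"
  shows "\<ominus>\<^bsub>mk_module S (add R) \<zero> sm\<^esub> x = \<ominus> x"
proof -
  interpret S: additive_subgroup S R by fact
  interpret M: abelian_group "mk_module S (add R) \<zero> sm" by (rule mk_module_abelian_group[OF assms(1)])
  show ?thesis
    using assms(2) by (intro M.minus_equality) (simp_all add: l_neg)
qed

lemma mk_module_submodule_iff:
  assumes S: "additive_subgroup S R"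
  shows "submodule N Q (mk_module S (add R) \<zero> sm) \<longleftrightarrow>
    additive_subgroup N R \<and> N \<subseteq> S \<and> (\<forall>r\<in>carrier Q. \<forall>x\<in>N. sm r x \<in> N)"
proof -
  interpret S: additive_subgroup S R by fact
  interpret M: abelian_group "mk_module S (add R) \<zero> sm" by (rule mk_module_abelian_group[OF S])
  have "subgroup N (add_monoid (mk_module S (add R) \<zero> sm)) \<longleftrightarrow> additive_subgroup N R \<and> N \<subseteq> S"
  proof
    assume "subgroup N (add_monoid (mk_module S (add R) \<zero> sm))"
    then interpret N: additive_subgroup N "mk_module S (add R) \<zero> sm" by (rule additive_subgroupI)
    have sub: "N \<subseteq> S" using N.a_subset by simp
    have "additive_subgroup N R"
    proof (rule additive_subgroupI, rule add.subgroupI)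
      show "N \<subseteq> carrier R" using sub S.a_subset by blast
      show "N \<noteq> {}" using N.zero_closed by blast
      show "\<ominus> x \<in> N" if "x \<in> N" for x
        using N.a_inv_closed[OF that] mk_module_a_inv[OF S subsetD[OF sub that], of sm] by simp
      show "x \<oplus> y \<in> N" if "x \<in> N" "y \<in> N" for x y
        using N.a_closed[OF that] by simp
    qed
    then show "additive_subgroup N R \<and> N \<subseteq> S" using sub by blast
  next
    assume N: "additive_subgroup N R \<and> N \<subseteq> S"
    then interpret N: additive_subgroup N R by blast
    show "subgroup N (add_monoid (mk_module S (add R) \<zero> sm))"
    proof (rule M.add.subgroupI)
      show "N \<noteq> {}" using N.zero_closed by blast
      show "\<ominus>\<^bsub>mk_module S (add R) \<zero> sm\<^esub> x \<in> N" if "x \<in> N" for x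
        using N.a_inv_closed[OF that] mk_module_a_inv[OF S, of x sm] N that by auto
    qed (use N in simp_all)
  qed
  then show ?thesis
    by (simp add: submodule_def submodule_axioms_def Ball_def)
qed

lemma mk_module_operator_group:
  assumes "additive_subgroup S R"
    and "\<And>r x. \<lbrakk>r \<in> carrier Q; x \<in> S\<rbrakk> \<Longrightarrow> sm r x \<in> S"
    and "\<And>r x y. \<lbrakk>r \<in> carrier Q; x \<in> S; y \<in> S\<rbrakk> \<Longrightarrow> sm r (x \<oplus> y) = sm r x \<oplus> sm r y"
  shows "operator_group Q (mk_module S (add R) \<zero> sm)"
  using assms by (intro operator_group.intro operator_group_axioms.intro mk_module_abelian_group) simp_all

end

section \<open>The top radical layer\<close>

text \<open>The ring-theoretic content of being a basic finite-dimensional algebra with \<open>J\<^sup>n = 0\<close>: the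
  corners at the given idempotents are local, and everything off the diagonal is radical.\<close>
locale basic_ring = ring R for R (structure) +
  fixes n t :: nat and e :: "nat \<Rightarrow> 'a"
  assumes n_pos: "n \<ge> 1"
    and radical_nilpotent: "rad_pow R n = {\<zero>}"
    and idempotents: "complete_primitive_idempotents R t e"
    and off_diagonal_in_radical: "\<lbrakk>h \<in> {1..t}; h' \<in> {1..t}; h \<noteq> h'; x \<in> carrier R;
      e h \<otimes> x = x; x \<otimes> e h' = x\<rbrakk> \<Longrightarrow> x \<in> jacobson_radical R"
    and corner_local: "\<lbrakk>h \<in> {1..t}; x \<in> carrier (corner_ring R (e h)); x \<notin> jacobson_radical R\<rbrakk> \<Longrightarrow>
      \<exists>y\<in>carrier (corner_ring R (e h)). x \<otimes> y = e h \<and> y \<otimes> x = e h"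
begin

lemma idem:
  assumes "h \<in> {1..t}"
  shows "e h \<in> carrier R" "e h \<otimes> e h = e h" "e h \<noteq> \<zero>"
  using assms idempotents by (auto simp: complete_primitive_idempotents_def primitive_idempotent_def)

lemma idem_orthogonal: "\<lbrakk>h \<in> {1..t}; h' \<in> {1..t}; h \<noteq> h'\<rbrakk> \<Longrightarrow> e h \<otimes> e h' = \<zero>"
  using idempotents by (auto simp: complete_primitive_idempotents_def)

lemma sum_idem: "(\<Oplus>h\<in>{1..t}. e h) = \<one>"
  using idempotents by (simp add: complete_primitive_idempotents_def)

sublocale J: ideal "jacobson_radical R" R
  by (rule jacobson_radical_ideal)

sublocale T: ideal "rad_pow R (n - 1)" R
  by (rule rad_pow_ideal)

lemma top_mult_radical:
  assumes "x \<in> rad_pow R (n - 1)" "z \<in> jacobson_radical R"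
  shows "x \<otimes> z = \<zero>" "z \<otimes> x = \<zero>"
  using rad_pow_mult_right[OF assms] rad_pow_mult_left[OF assms] n_pos radical_nilpotent by simp_all

lemma idempotent_notin_radical:
  assumes "f \<in> carrier R" "f \<otimes> f = f" "f \<noteq> \<zero>"
  shows "f \<notin> jacobson_radical R"
proof
  assume "f \<in> jacobson_radical R"
  then have "f [^] n = \<zero>" using jacobson_pow_in_rad_pow[of f n] radical_nilpotent by simp
  moreover have "f [^] Suc m = f" for m :: nat
    using assms(1,2) by (induction m) simp_all
  ultimately show False using n_pos assms(3) by (metis Suc_pred' less_eq_Suc_le One_nat_def)
qed

text \<open>A representative of a unit of \<open>D\<^sub>h\<close> is not radical, since it becomes invertible modulo \<open>J\<close>;
  as the corner is local, it is invertible there already.\<close>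
lemma residue_unit_lift:
  assumes h: "h \<in> {1..t}" and c: "c \<in> Units (division_alg R (e h))"
  obtains x y where "x \<in> carrier (corner_ring R (e h))" "y \<in> carrier (corner_ring R (e h))"
    "x \<otimes> y = e h" "y \<otimes> x = e h" "c = residue (e h) x"
proof -
  note p = idem(1,2)[OF h]
  interpret C: ring "corner_ring R (e h)" by (rule corner_ring_is_ring[OF p])
  obtain d where d: "d \<in> carrier (division_alg R (e h))"
    "c \<otimes>\<^bsub>division_alg R (e h)\<^esub> d = \<one>\<^bsub>division_alg R (e h)\<^esub>" and cc: "c \<in> carrier (division_alg R (e h))"
    using c unfolding Units_def by blast
  obtain x where x: "x \<in> carrier (corner_ring R (e h))" "c = residue (e h) x"
    using cc unfolding division_alg_carrier by blast
  obtain z where z: "z \<in> carrier (corner_ring R (e h))" "d = residue (e h) z"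
    using d(1) unfolding division_alg_carrier by blast
  have one: "e h \<in> carrier (corner_ring R (e h))" using p by (simp add: corner_carrier_iff[OF p])
  have xz: "x \<otimes> z \<in> carrier (corner_ring R (e h))"
    using C.m_closed[OF x(1) z(1)] by (simp add: corner_ring_simps)
  \<comment> \<open>A radical \<open>x\<close> would make \<open>e\<^sub>h = x z - (x z - e\<^sub>h)\<close> radical.\<close>
  have "residue (e h) (x \<otimes> z) = residue (e h) (e h)"
    using d(2) unfolding x(2) z(2) division_alg_one division_alg_mult[OF p x(1) z(1)] .
  then have diff: "x \<otimes> z \<oplus> \<ominus> e h \<in> jacobson_radical R"
    unfolding residue_eq_iff[OF p xz one] .
  have xR: "x \<in> carrier R" and zR: "z \<in> carrier R"
    using x(1) z(1) by (simp_all add: corner_carrier_iff[OF p])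
  have "x \<notin> jacobson_radical R"
  proof
    assume "x \<in> jacobson_radical R"
    then have "x \<otimes> z \<in> jacobson_radical R" using zR by (rule J.I_r_closed)
    then have "x \<otimes> z \<oplus> \<ominus> (x \<otimes> z \<oplus> \<ominus> e h) \<in> jacobson_radical R"
      using diff by blast
    moreover have "x \<otimes> z \<oplus> \<ominus> (x \<otimes> z \<oplus> \<ominus> e h) = e h"
      using xR zR p(1) by (simp add: minus_add a_assoc[symmetric] r_neg)
    ultimately show False using idempotent_notin_radical idem[OF h] by simp
  qed
  then show thesis using corner_local[OF h x(1)] that x by blast
qed

lemma residue_unitI:
  assumes h: "h \<in> {1..t}" and x: "x \<in> carrier (corner_ring R (e h))"
    and y: "y \<in> carrier (corner_ring R (e h))" and inv: "x \<otimes> y = e h" "y \<otimes> x = e h"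
  shows "residue (e h) x \<in> Units (division_alg R (e h))"
proof -
  note p = idem(1,2)[OF h]
  have "residue (e h) x \<in> carrier (division_alg R (e h))" "residue (e h) y \<in> carrier (division_alg R (e h))"
    using x y by (simp_all add: division_alg_carrier)
  moreover have "residue (e h) y \<otimes>\<^bsub>division_alg R (e h)\<^esub> residue (e h) x = \<one>\<^bsub>division_alg R (e h)\<^esub>"
    "residue (e h) x \<otimes>\<^bsub>division_alg R (e h)\<^esub> residue (e h) y = \<one>\<^bsub>division_alg R (e h)\<^esub>"
    by (simp_all add: division_alg_mult[OF p] x y inv division_alg_one)
  ultimately show ?thesis unfolding Units_def by blast
qed

end

locale top_layer = basic_ring +
  fixes i j :: nat
  assumes i: "i \<in> {1..t}" and j: "j \<in> {1..t}"
begin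

abbreviation "V \<equiv> carrier (top_bimodule R n (e j) (e i))"
abbreviation "D\<^sub>i \<equiv> division_alg R (e i)"
abbreviation "D\<^sub>j \<equiv> division_alg R (e j)"
abbreviation "corner \<equiv> carrier (corner_ring R (e i))"

lemma V_iff: "v \<in> V \<longleftrightarrow> v \<in> rad_pow R (n - 1) \<and> e j \<otimes> v = v \<and> v \<otimes> e i = v"
  using peirce_ideal_iff[OF rad_pow_ideal idem(1,2)[OF j] idem(1,2)[OF i]]
  by (simp add: top_bimodule_def)

lemma corner_iff: "x \<in> corner \<longleftrightarrow> x \<in> carrier R \<and> e i \<otimes> x = x \<and> x \<otimes> e i = x"
  by (rule corner_carrier_iff[OF idem(1,2)[OF i]])

lemma V_carrier: "v \<in> V \<Longrightarrow> v \<in> carrier R"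
  by (simp add: V_iff)

lemma V_subgroup: "additive_subgroup V R"
proof (rule additive_subgroupI, rule add.subgroupI)
  note c = idem(1)[OF i] idem(1)[OF j]
  show "V \<subseteq> carrier R" using V_carrier by blast
  have "\<zero> \<in> V" unfolding V_iff using c T.zero_closed by simp
  then show "V \<noteq> {}" by blast
qed (use idem(1)[OF i] idem(1)[OF j] in \<open>simp_all add: V_iff l_minus r_minus l_distr r_distr del: One_nat_def\<close>)

text \<open>Two representatives of a coset differ by an element of \<open>J\<close>, which kills the top layer.\<close>
lemma coset_lmult_residue:
  assumes x: "x \<in> carrier R" and v: "v \<in> V"
  shows "coset_lmult R (residue (e j) x) v = x \<otimes> v"
proof -
  note p = idem(1,2)[OF j]
  have "y \<otimes> v = x \<otimes> v" if y: "y \<in> residue (e j) x" for y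
  proof -
    obtain z where z: "z \<in> jacobson_radical R" "e j \<otimes> z = z" "z \<otimes> e j = z" "y = z \<oplus> x"
      by (rule in_residueE[OF p y])
    have "z \<otimes> v = \<zero>" using v unfolding V_iff by (intro top_mult_radical(2)[OF _ z(1)]) blast
    then show ?thesis
      unfolding z(4) using l_distr[OF J.Icarr[OF z(1)] x V_carrier[OF v]] x V_carrier[OF v] by simp
  qed
  then have "(\<lambda>y. y \<otimes> v) ` residue (e j) x = (\<lambda>_. x \<otimes> v) ` residue (e j) x"
    by (intro image_cong refl)
  also have "\<dots> = {x \<otimes> v}" using in_residue_self[OF p x] by (rule image_constant)
  finally have "(\<lambda>y. y \<otimes> v) ` residue (e j) x = {x \<otimes> v}" .
  then show ?thesis by (simp add: coset_lmult_def)
qed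

lemma coset_rmult_residue:
  assumes x: "x \<in> carrier R" and v: "v \<in> V"
  shows "coset_rmult R v (residue (e i) x) = v \<otimes> x"
proof -
  note p = idem(1,2)[OF i]
  have "v \<otimes> y = v \<otimes> x" if y: "y \<in> residue (e i) x" for y
  proof -
    obtain z where z: "z \<in> jacobson_radical R" "e i \<otimes> z = z" "z \<otimes> e i = z" "y = z \<oplus> x"
      by (rule in_residueE[OF p y])
    have "v \<otimes> z = \<zero>" using v unfolding V_iff by (intro top_mult_radical(1)[OF _ z(1)]) blast
    then show ?thesis
      unfolding z(4) using r_distr[OF J.Icarr[OF z(1)] x V_carrier[OF v]] x V_carrier[OF v] by simp
  qed
  then have "(\<lambda>y. v \<otimes> y) ` residue (e i) x = (\<lambda>_. v \<otimes> x) ` residue (e i) x"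
    by (intro image_cong refl)
  also have "\<dots> = {v \<otimes> x}" using in_residue_self[OF p x] by (rule image_constant)
  finally have "(\<lambda>y. v \<otimes> y) ` residue (e i) x = {v \<otimes> x}" .
  then show ?thesis by (simp add: coset_rmult_def)
qed

lemma right_translate_residue:
  assumes "x \<in> corner" "U \<subseteq> V"
  shows "right_translate R U (residue (e i) x) = (\<lambda>u. u \<otimes> x) ` U"
  unfolding right_translate_def
  using assms coset_rmult_residue corner_iff by (intro image_cong refl) blast

lemma V_lmult_closed:
  assumes "x \<in> carrier (corner_ring R (e j))" "v \<in> V"
  shows "x \<otimes> v \<in> V"
proof -
  have x: "x \<in> carrier R" "e j \<otimes> x = x" using assms(1) by (simp_all add: corner_carrier_iff[OF idem(1,2)[OF j]])
  have v: "v \<in> rad_pow R (n - 1)" "v \<otimes> e i = v" "v \<in> carrier R"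
    using assms(2) V_carrier unfolding V_iff by blast+
  show ?thesis
    unfolding V_iff
    using T.I_l_closed[OF v(1) x(1)] m_assoc[OF idem(1)[OF j] x(1) v(3)] m_assoc[OF x(1) v(3) idem(1)[OF i]]
      x(2) v(2) by simp
qed

lemma V_rmult_closed:
  assumes "x \<in> corner" "v \<in> V"
  shows "v \<otimes> x \<in> V"
proof -
  have x: "x \<in> carrier R" "x \<otimes> e i = x" using assms(1) by (simp_all add: corner_iff)
  have v: "v \<in> rad_pow R (n - 1)" "e j \<otimes> v = v" "v \<in> carrier R"
    using assms(2) V_carrier unfolding V_iff by blast+
  show ?thesis
    unfolding V_iff
    using T.I_r_closed[OF v(1) x(1)] m_assoc[OF idem(1)[OF j] v(3) x(1)] m_assoc[OF v(3) x(1) idem(1)[OF i]]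
      x(2) v(2) by simp
qed

lemma top_bimodule_operator_group: "operator_group D\<^sub>j (top_bimodule R n (e j) (e i))"
proof -
  have eq: "top_bimodule R n (e j) (e i) = mk_module V (add R) \<zero> (coset_lmult R)"
    by (simp add: top_bimodule_def)
  have lift: "\<exists>x\<in>carrier (corner_ring R (e j)). r = residue (e j) x" if "r \<in> carrier D\<^sub>j" for r
    using that unfolding division_alg_carrier by blast
  have "operator_group D\<^sub>j (mk_module V (add R) \<zero> (coset_lmult R))"
  proof (rule mk_module_operator_group[OF V_subgroup])
    fix r v assume r: "r \<in> carrier D\<^sub>j" and v: "v \<in> V"
    obtain x where x: "x \<in> carrier (corner_ring R (e j))" "r = residue (e j) x" using lift[OF r] by blast
    have xR: "x \<in> carrier R" using x(1) corner_carrier_iff[OF idem(1,2)[OF j]] by blast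
    show "coset_lmult R r v \<in> V"
      unfolding x(2) coset_lmult_residue[OF xR v] by (rule V_lmult_closed[OF x(1) v])
    fix w assume w: "w \<in> V"
    have vw: "v \<oplus> w \<in> V" using v w additive_subgroup.a_closed[OF V_subgroup] by blast
    show "coset_lmult R r (v \<oplus> w) = coset_lmult R r v \<oplus> coset_lmult R r w"
      unfolding x(2) coset_lmult_residue[OF xR v] coset_lmult_residue[OF xR w] coset_lmult_residue[OF xR vw]
      using xR V_carrier v w by (simp add: r_distr)
  qed
  then show ?thesis using eq by simp
qed

lemma V_submodule_iff:
  "submodule U D\<^sub>j (top_bimodule R n (e j) (e i)) \<longleftrightarrow> additive_subgroup U R \<and> U \<subseteq> V \<and>
    (\<forall>x\<in>carrier (corner_ring R (e j)). \<forall>u\<in>U. x \<otimes> u \<in> U)"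
proof -
  have eq: "top_bimodule R n (e j) (e i) = mk_module V (add R) \<zero> (coset_lmult R)"
    by (simp add: top_bimodule_def)
  have "coset_lmult R (residue (e j) x) u = x \<otimes> u"
    if "x \<in> carrier (corner_ring R (e j))" "u \<in> U" "U \<subseteq> V" for x u
    using that coset_lmult_residue[of x u] corner_carrier_iff[OF idem(1,2)[OF j]] by blast
  then have "(\<forall>r\<in>carrier D\<^sub>j. \<forall>u\<in>U. coset_lmult R r u \<in> U)
      \<longleftrightarrow> (\<forall>x\<in>carrier (corner_ring R (e j)). \<forall>u\<in>U. x \<otimes> u \<in> U)" if "U \<subseteq> V"
    using that by (simp add: division_alg_carrier)
  moreover have "submodule U D\<^sub>j (top_bimodule R n (e j) (e i)) \<longleftrightarrow> additive_subgroup U R \<and> U \<subseteq> V \<and>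
      (\<forall>r\<in>carrier D\<^sub>j. \<forall>u\<in>U. coset_lmult R r u \<in> U)"
    by (subst eq) (rule mk_module_submodule_iff[OF V_subgroup])
  ultimately show ?thesis by blast
qed

text \<open>Right multiplication by a unit of \<open>e\<^sub>i R e\<^sub>i\<close> is a \<open>D\<^sub>j\<close>-automorphism of \<open>V\<close>, hence
  preserves codimensions.\<close>
lemma Gr_translate_closed:
  assumes U: "U \<in> top_Gr R n s (e j) (e i)"
    and x: "x \<in> corner" "y \<in> corner" "x \<otimes> y = e i" "y \<otimes> x = e i"
  shows "(\<lambda>u. u \<otimes> x) ` U \<in> top_Gr R n s (e j) (e i)"
proof -
  let ?V = "top_bimodule R n (e j) (e i)" and ?U' = "(\<lambda>u. u \<otimes> x) ` U"
  have subU: "submodule U D\<^sub>j ?V" and dimU: "module_dim D\<^sub>j (quot_module ?V U) = s"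
    using U by (simp_all add: top_Gr_def)
  have U': "additive_subgroup U R" "U \<subseteq> V"
    "\<And>z u. z \<in> carrier (corner_ring R (e j)) \<Longrightarrow> u \<in> U \<Longrightarrow> z \<otimes> u \<in> U"
    using subU by (simp_all add: V_submodule_iff)
  interpret U: additive_subgroup U R by (rule U'(1))
  have xR: "x \<in> carrier R" "y \<in> carrier R" using x corner_iff by blast+
  have inv: "v \<otimes> x \<otimes> y = v" "v \<otimes> y \<otimes> x = v" if "v \<in> V" for v
    using that xR x(3,4) V_carrier[OF that] by (simp_all add: m_assoc V_iff)
  have "submodule ?U' D\<^sub>j ?V"
    unfolding V_submodule_iff
  proof (intro conjI ballI)
    show "additive_subgroup ?U' R"
    proof (rule additive_subgroupI, rule add.subgroupI)
      show "?U' \<subseteq> carrier R" using xR by auto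
      show "?U' \<noteq> {}" using U.zero_closed by blast
      show "\<ominus> a \<in> ?U'" if a: "a \<in> ?U'" for a
      proof -
        obtain u where u: "u \<in> U" "a = u \<otimes> x" using a by blast
        then have "\<ominus> a = (\<ominus> u) \<otimes> x" using xR by (simp add: l_minus)
        then show ?thesis using u by blast
      qed
      show "a \<oplus> b \<in> ?U'" if ab: "a \<in> ?U'" "b \<in> ?U'" for a b
      proof -
        obtain u w where u: "u \<in> U" "a = u \<otimes> x" "w \<in> U" "b = w \<otimes> x" using ab by blast
        then have "a \<oplus> b = (u \<oplus> w) \<otimes> x" using xR by (simp add: l_distr)
        then show ?thesis using u by blast
      qed
    qed
    show "?U' \<subseteq> V" using U'(2) V_rmult_closed[OF x(1)] by blast
    show "z \<otimes> a \<in> ?U'" if z: "z \<in> carrier (corner_ring R (e j))" and a: "a \<in> ?U'" for z a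
    proof -
      obtain u where u: "u \<in> U" "a = u \<otimes> x" using a by blast
      have "z \<in> carrier R" using z corner_carrier_iff[OF idem(1,2)[OF j]] by blast
      then have "z \<otimes> a = (z \<otimes> u) \<otimes> x" using u xR by (simp add: m_assoc)
      then show ?thesis using U'(3)[OF z u(1)] by blast
    qed
  qed
  moreover have "module_dim D\<^sub>j (quot_module ?V ?U') = s"
  proof -
    interpret VO: operator_group "D\<^sub>j" ?V by (rule top_bimodule_operator_group)
    have add: "a \<oplus>\<^bsub>?V\<^esub> b = a \<oplus> b" for a b by (simp add: top_bimodule_def)
    have smult: "residue (e j) z \<odot>\<^bsub>?V\<^esub> v = z \<otimes> v" if "z \<in> carrier (corner_ring R (e j))" "v \<in> V" for z v
      using that coset_lmult_residue[of z v] corner_carrier_iff[OF idem(1,2)[OF j]]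
      by (simp add: top_bimodule_def)
    have "module_iso D\<^sub>j (quot_module ?V U) (quot_module ?V ?U')"
    proof (rule VO.quot_module_iso_of_automorphism[where f = "\<lambda>v. v \<otimes> x"])
      show "submodule U D\<^sub>j ?V" "submodule ?U' D\<^sub>j ?V" by fact+
      show "(\<lambda>v. v \<otimes> x) ` V = V"
      proof
        show "(\<lambda>v. v \<otimes> x) ` V \<subseteq> V" using V_rmult_closed[OF x(1)] by blast
        show "V \<subseteq> (\<lambda>v. v \<otimes> x) ` V"
        proof
          fix v assume v: "v \<in> V"
          then have "v = (v \<otimes> y) \<otimes> x" using inv by simp
          then show "v \<in> (\<lambda>v. v \<otimes> x) ` V" using V_rmult_closed[OF x(2) v] by blast
        qed
      qed
      show "(v \<oplus>\<^bsub>?V\<^esub> w) \<otimes> x = v \<otimes> x \<oplus>\<^bsub>?V\<^esub> w \<otimes> x" if "v \<in> V" "w \<in> V" for v w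
        using that V_carrier xR by (simp add: add l_distr)
      show "(r \<odot>\<^bsub>?V\<^esub> v) \<otimes> x = r \<odot>\<^bsub>?V\<^esub> (v \<otimes> x)" if r: "r \<in> carrier D\<^sub>j" and v: "v \<in> V" for r v
      proof -
        obtain z where z: "z \<in> carrier (corner_ring R (e j))" "r = residue (e j) z"
          using r unfolding division_alg_carrier by blast
        have "z \<in> carrier R" using z(1) corner_carrier_iff[OF idem(1,2)[OF j]] by blast
        then show ?thesis
          using smult[OF z(1) v] smult[OF z(1) V_rmult_closed[OF x(1) v]] V_carrier[OF v] xR
          by (simp add: z(2) m_assoc)
      qed
      show "v \<otimes> x \<in> ?U' \<longleftrightarrow> v \<in> U" if v: "v \<in> V" for v
      proof
        assume "v \<otimes> x \<in> ?U'"
        then obtain u where u: "u \<in> U" "v \<otimes> x = u \<otimes> x" by blast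
        have "v = v \<otimes> x \<otimes> y" using inv(1)[OF v] by simp
        also have "\<dots> = u" unfolding u(2) using inv(1) u(1) U'(2) by blast
        finally show "v \<in> U" using u(1) by simp
      qed blast
    qed
    then show ?thesis
      using module_dim_cong_iso[OF VO.quot_operator_group[OF subU]
          VO.quot_operator_group[OF \<open>submodule ?U' D\<^sub>j ?V\<close>]] dimU by simp
  qed
  ultimately show ?thesis by (simp add: top_Gr_def)
qed

text \<open>The quotient \<open>V/V\<close> has dimension \<open>0\<close>.\<close>
lemma Gr_proper:
  assumes U: "U \<in> top_Gr R n s (e j) (e i)" and s: "s \<ge> 1"
  shows "U \<noteq> V"
proof
  let ?V = "top_bimodule R n (e j) (e i)"
  assume eq: "U = V"
  note p = idem(1,2)[OF j]
  interpret VO: operator_group "D\<^sub>j" ?V by (rule top_bimodule_operator_group)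
  interpret D: ring "D\<^sub>j" by (rule division_alg_ring[OF p])
  have subU: "submodule U D\<^sub>j ?V" using U by (simp add: top_Gr_def)
  interpret U: abelian_subgroup U ?V by (rule VO.submodule_abelian_subgroup[OF subU])
  have "carrier (quot_module ?V U) = {\<zero>\<^bsub>quot_module ?V U\<^esub>}"
  proof -
    have "U +>\<^bsub>?V\<^esub> x = U" if "x \<in> V" for x using U.a_rcos_const that eq by blast
    then show ?thesis
      using VO.zero_closed unfolding quot_module_simps A_RCOSETS_def' by blast
  qed
  moreover have "\<one>\<^bsub>D\<^sub>j\<^esub> \<noteq> \<zero>\<^bsub>D\<^sub>j\<^esub>"
  proof
    assume "\<one>\<^bsub>D\<^sub>j\<^esub> = \<zero>\<^bsub>D\<^sub>j\<^esub>"
    then have "residue (e j) (e j) = peirce R (e j) (jacobson_radical R) (e j)"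
      unfolding division_alg_one by (simp add: division_alg_def FactRing_def)
    then have "e j \<in> peirce R (e j) (jacobson_radical R) (e j)"
      using in_residue_self[OF p p(1)] by simp
    then have "e j \<in> jacobson_radical R"
      using peirce_ideal_iff[OF jacobson_radical_ideal p p] by blast
    then show False using idempotent_notin_radical idem[OF j] by blast
  qed
  ultimately have "module_dim D\<^sub>j (quot_module ?V U) = 0"
    using module_dim_zero[OF VO.quot_operator_group[OF subU] D.one_closed] by blast
  then show False using U s by (simp add: top_Gr_def)
qed

end

section \<open>The submodules \<open>K\<^sub>U\<close>\<close>

context top_layer
begin

abbreviation "P \<equiv> carrier (proj R (e i))"
abbreviation "K U \<equiv> K_sub R n t e i j U"

lemma P_iff: "x \<in> P \<longleftrightarrow> x \<in> carrier R \<and> x \<otimes> e i = x"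
proof
  assume "x \<in> P"
  then obtain a where "a \<in> carrier R" "x = a \<otimes> e i" by (auto simp: proj_def)
  then show "x \<in> carrier R \<and> x \<otimes> e i = x" using idem[OF i] by (simp add: m_assoc)
next
  assume x: "x \<in> carrier R \<and> x \<otimes> e i = x"
  then have "x = x \<otimes> e i" by simp
  then show "x \<in> P" using x unfolding proj_def left_ideal_module_simps by blast
qed

lemma P_subgroup: "additive_subgroup P R"
proof (rule additive_subgroupI, rule add.subgroupI)
  show "P \<subseteq> carrier R" using P_iff by blast
  have "\<zero> \<in> P" unfolding P_iff using idem[OF i] by simp
  then show "P \<noteq> {}" by blast
qed (use idem(1)[OF i] in \<open>simp_all add: P_iff l_minus l_distr\<close>)

lemma radical_layer_of_P:
  "ideal_prod R (rad_pow R (n - 1)) P = {x \<in> rad_pow R (n - 1). x \<otimes> e i = x}"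
proof (intro equalityI subsetI)
  fix x assume "x \<in> ideal_prod R (rad_pow R (n - 1)) P"
  then show "x \<in> {x \<in> rad_pow R (n - 1). x \<otimes> e i = x}"
  proof (induction x rule: ideal_prod.induct)
    case (prod a b)
    then have b: "b \<in> carrier R" "b \<otimes> e i = b" and a: "a \<in> carrier R"
      using P_iff T.Icarr by blast+
    have "a \<otimes> b \<in> rad_pow R (n - 1)" using prod(1) b(1) by (rule T.I_r_closed)
    then show ?case using a b idem(1)[OF i] by (simp add: m_assoc)
  next
    case (sum a b)
    then have "a \<in> rad_pow R (n - 1)" "b \<in> rad_pow R (n - 1)" "a \<otimes> e i = a" "b \<otimes> e i = b" by auto
    moreover from this have "a \<oplus> b \<in> rad_pow R (n - 1)" by (intro T.a_closed)
    ultimately show ?case using T.Icarr idem(1)[OF i] by (simp add: l_distr)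
  qed
next
  fix x assume x: "x \<in> {x \<in> rad_pow R (n - 1). x \<otimes> e i = x}"
  have "e i \<in> P" unfolding P_iff using idem[OF i] by simp
  then have "x \<otimes> e i \<in> ideal_prod R (rad_pow R (n - 1)) P" using x by (intro ideal_prod.prod) auto
  then show "x \<in> ideal_prod R (rad_pow R (n - 1)) P" using x by simp
qed

text \<open>The sum of the \<open>e\<^sub>h J\<^bsup>n-1\<^esup> P\<^sub>i\<close> with \<open>h \<noteq> j\<close> is the part of \<open>J\<^bsup>n-1\<^esup> P\<^sub>i\<close> killed by \<open>e\<^sub>j\<close>, because
  \<open>x\<close> is the sum of all \<open>e\<^sub>h x\<close>.\<close>
lemma W_sum_iff:
  "x \<in> W_sum R n t e i j \<longleftrightarrow> x \<in> rad_pow R (n - 1) \<and> x \<otimes> e i = x \<and> e j \<otimes> x = \<zero>"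
proof
  assume "x \<in> W_sum R n t e i j"
  then obtain w where x: "x = (\<Oplus>h\<in>{1..t} - {j}. w h)"
    and w: "\<And>h. h \<in> {1..t} - {j} \<Longrightarrow> w h \<in> (\<lambda>p. e h \<otimes> p) ` ideal_prod R (rad_pow R (n - 1)) P"
    unfolding W_sum_def by blast
  let ?S = "{x \<in> rad_pow R (n - 1). x \<otimes> e i = x \<and> e j \<otimes> x = \<zero>}"
  have S: "additive_subgroup ?S R"
  proof (rule additive_subgroupI, rule add.subgroupI)
    show "?S \<subseteq> carrier R" using T.Icarr by blast
    have "\<zero> \<in> ?S" using T.zero_closed idem(1)[OF i] idem(1)[OF j] by simp
    then show "?S \<noteq> {}" by blast
  qed (use T.Icarr idem(1)[OF i] idem(1)[OF j] in
      \<open>simp_all add: l_minus r_minus l_distr r_distr del: One_nat_def\<close>)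
  have "w h \<in> ?S" if h: "h \<in> {1..t} - {j}" for h
  proof -
    obtain p where p: "p \<in> rad_pow R (n - 1)" "p \<otimes> e i = p" "w h = e h \<otimes> p"
      using w[OF h] unfolding radical_layer_of_P by blast
    have eh: "e h \<in> carrier R" "e j \<otimes> e h = \<zero>" using h j idem(1) idem_orthogonal[of j h] by auto
    have pc: "p \<in> carrier R" using p(1) by (rule T.Icarr)
    have "e h \<otimes> p \<in> rad_pow R (n - 1)" using p(1) eh(1) by (rule T.I_l_closed)
    moreover have "e h \<otimes> p \<otimes> e i = e h \<otimes> p" using eh pc p(2) idem(1)[OF i] by (simp add: m_assoc)
    moreover have "e j \<otimes> (e h \<otimes> p) = \<zero>"
      using eh pc idem(1)[OF j] by (simp add: m_assoc[symmetric])
    ultimately show ?thesis unfolding p(3) by blast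
  qed
  then have "x \<in> ?S" unfolding x by (intro finsum_in_additive_subgroup[OF S]) auto
  then show "x \<in> rad_pow R (n - 1) \<and> x \<otimes> e i = x \<and> e j \<otimes> x = \<zero>" by blast
next
  assume x: "x \<in> rad_pow R (n - 1) \<and> x \<otimes> e i = x \<and> e j \<otimes> x = \<zero>"
  have xc: "x \<in> carrier R" using x T.Icarr by blast
  have eh: "e h \<otimes> x \<in> carrier R" if "h \<in> {1..t}" for h using that idem(1) xc by blast
  have "x = (\<Oplus>h\<in>{1..t}. e h) \<otimes> x" using xc by (simp only: sum_idem l_one)
  also have "\<dots> = (\<Oplus>h\<in>{1..t}. e h \<otimes> x)"
    using idem(1) xc by (intro finsum_ldistr) auto
  also have "\<dots> = (\<Oplus>h\<in>insert j ({1..t} - {j}). e h \<otimes> x)"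
    using j by (simp only: insert_Diff)
  also have "\<dots> = e j \<otimes> x \<oplus> (\<Oplus>h\<in>{1..t} - {j}. e h \<otimes> x)"
    using eh j by (intro finsum_insert) auto
  also have "\<dots> = (\<Oplus>h\<in>{1..t} - {j}. e h \<otimes> x)"
    using x eh by (simp add: finsum_closed Pi_iff)
  finally have "x = (\<Oplus>h\<in>{1..t} - {j}. e h \<otimes> x)" .
  moreover have "x \<in> ideal_prod R (rad_pow R (n - 1)) P"
    unfolding radical_layer_of_P using x by blast
  ultimately show "x \<in> W_sum R n t e i j" unfolding W_sum_def by blast
qed

text \<open>Membership in \<open>K\<^sub>U\<close> is tested on the \<open>e\<^sub>j\<close>-component alone.\<close>
lemma K_iff:
  assumes U: "additive_subgroup U R" "U \<subseteq> V"
  shows "x \<in> K U \<longleftrightarrow> x \<in> rad_pow R (n - 1) \<and> x \<otimes> e i = x \<and> e j \<otimes> x \<in> U"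
proof
  assume "x \<in> K U"
  then obtain w u where x: "x = w \<oplus> u" and w: "w \<in> W_sum R n t e i j" and u: "u \<in> U"
    unfolding K_sub_def set_add_def' by blast
  have w': "w \<in> rad_pow R (n - 1)" "w \<otimes> e i = w" "e j \<otimes> w = \<zero>" using w by (simp_all add: W_sum_iff)
  have u': "u \<in> rad_pow R (n - 1)" "u \<otimes> e i = u" "e j \<otimes> u = u" using u U(2) V_iff by blast+
  have c: "w \<in> carrier R" "u \<in> carrier R" using w'(1) u'(1) T.Icarr by blast+
  have "w \<oplus> u \<in> rad_pow R (n - 1)" using w'(1) u'(1) by (rule T.a_closed)
  then show "x \<in> rad_pow R (n - 1) \<and> x \<otimes> e i = x \<and> e j \<otimes> x \<in> U"
    unfolding x using c w' u' u idem(1)[OF i] idem(1)[OF j] by (simp add: l_distr r_distr)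
next
  assume x: "x \<in> rad_pow R (n - 1) \<and> x \<otimes> e i = x \<and> e j \<otimes> x \<in> U"
  have xc: "x \<in> carrier R" using x T.Icarr by blast
  define w where "w = x \<oplus> \<ominus> (e j \<otimes> x)"
  have u': "e j \<otimes> x \<in> rad_pow R (n - 1)" "e j \<otimes> x \<in> carrier R" "e j \<otimes> x \<otimes> e i = e j \<otimes> x"
    using x U(2) V_iff T.Icarr by blast+
  have "w \<in> rad_pow R (n - 1)" unfolding w_def using x u'(1) by blast
  moreover have "w \<otimes> e i = w"
    unfolding w_def using x xc u' idem(1)[OF i] by (simp add: l_distr l_minus)
  moreover have "e j \<otimes> w = \<zero>"
  proof -
    have "e j \<otimes> (e j \<otimes> x) = e j \<otimes> x" using xc idem[OF j] by (simp add: m_assoc[symmetric])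
    then show ?thesis
      unfolding w_def using xc u'(2) idem(1)[OF j] by (simp add: r_distr r_minus r_neg)
  qed
  ultimately have "w \<in> W_sum R n t e i j" by (simp add: W_sum_iff)
  moreover have "x = w \<oplus> e j \<otimes> x" unfolding w_def using xc u'(2) by (simp add: a_assoc l_neg)
  ultimately show "x \<in> K U" unfolding K_sub_def set_add_def' using x by blast
qed

lemma proj_operator_group: "operator_group R (proj R (e i))"
proof -
  have eq: "proj R (e i) = mk_module P (add R) \<zero> (monoid.mult R)"
    by (simp add: proj_def left_ideal_module_def)
  have "operator_group R (mk_module P (add R) \<zero> (monoid.mult R))"
    using idem(1)[OF i] by (intro mk_module_operator_group[OF P_subgroup]) (simp_all add: P_iff m_assoc r_distr)
  then show ?thesis using eq by simp
qed

text \<open>For \<open>a \<in> R\<close> and \<open>x \<in> J\<^bsup>n-1\<^esup>\<close>, the component \<open>e\<^sub>j a x\<close> is \<open>e\<^sub>j a e\<^sub>j x\<close>, since the summands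
  \<open>e\<^sub>j a e\<^sub>h\<close> with \<open>h \<noteq> j\<close> are radical and annihilate the top layer.\<close>
lemma component_of_mult:
  assumes x: "x \<in> rad_pow R (n - 1)" and a: "a \<in> carrier R"
  shows "e j \<otimes> (a \<otimes> x) = (e j \<otimes> a \<otimes> e j) \<otimes> (e j \<otimes> x)"
proof -
  have xc: "x \<in> carrier R" using x by (rule T.Icarr)
  note ej = idem(1,2)[OF j]
  have carr: "e j \<otimes> a \<otimes> e h \<otimes> x \<in> carrier R" if "h \<in> {1..t}" for h using that idem(1) xc a ej(1) by blast
  have zero: "e j \<otimes> a \<otimes> e h \<otimes> x = \<zero>" if h: "h \<in> {1..t} - {j}" for h
  proof -
    have eh: "e h \<in> carrier R" "e h \<otimes> e h = e h" using idem h by blast+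
    have "e j \<otimes> (e j \<otimes> a \<otimes> e h) = e j \<otimes> a \<otimes> e h"
      using a ej eh(1) by (simp add: m_assoc[symmetric])
    moreover have "e j \<otimes> a \<otimes> e h \<otimes> e h = e j \<otimes> a \<otimes> e h"
      using a ej eh by (simp add: m_assoc)
    ultimately have "e j \<otimes> a \<otimes> e h \<in> jacobson_radical R"
      using off_diagonal_in_radical[OF j, of h "e j \<otimes> a \<otimes> e h"] h a ej eh by blast
    then show ?thesis by (rule top_mult_radical(2)[OF x])
  qed
  have "e j \<otimes> (a \<otimes> x) = (e j \<otimes> a) \<otimes> ((\<Oplus>h\<in>{1..t}. e h) \<otimes> x)"
    using xc a ej by (simp only: sum_idem l_one m_assoc)
  also have "\<dots> = (e j \<otimes> a) \<otimes> (\<Oplus>h\<in>{1..t}. e h \<otimes> x)"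
    using idem(1) xc by (subst finsum_ldistr) auto
  also have "\<dots> = (\<Oplus>h\<in>{1..t}. (e j \<otimes> a) \<otimes> (e h \<otimes> x))"
    using idem(1) xc a ej by (intro finsum_rdistr) auto
  also have "\<dots> = (\<Oplus>h\<in>{1..t}. e j \<otimes> a \<otimes> e h \<otimes> x)"
    using idem(1) xc a ej carr by (intro finsum_cong' refl) (auto simp: m_assoc)
  also have "\<dots> = (\<Oplus>h\<in>insert j ({1..t} - {j}). e j \<otimes> a \<otimes> e h \<otimes> x)"
    using j by (simp only: insert_Diff)
  also have "\<dots> = e j \<otimes> a \<otimes> e j \<otimes> x \<oplus> (\<Oplus>h\<in>{1..t} - {j}. e j \<otimes> a \<otimes> e h \<otimes> x)"
    using carr j by (intro finsum_insert) auto
  also have "(\<Oplus>h\<in>{1..t} - {j}. e j \<otimes> a \<otimes> e h \<otimes> x) = (\<Oplus>h\<in>{1..t} - {j}. \<zero>)"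
    using zero by (intro finsum_cong' refl) auto
  also have "e j \<otimes> a \<otimes> e j \<otimes> x \<oplus> (\<Oplus>h\<in>{1..t} - {j}. \<zero>) = (e j \<otimes> a \<otimes> e j) \<otimes> (e j \<otimes> x)"
  proof -
    have "(e j \<otimes> a \<otimes> e j) \<otimes> (e j \<otimes> x) = e j \<otimes> a \<otimes> (e j \<otimes> e j) \<otimes> x"
      using a xc ej(1) by (simp add: m_assoc)
    then show ?thesis using carr[OF j] ej(2) by simp
  qed
  finally show ?thesis .
qed

lemma K_submodule:
  assumes U: "submodule U D\<^sub>j (top_bimodule R n (e j) (e i))"
  shows "submodule (K U) R (proj R (e i))"
proof -
  have U': "additive_subgroup U R" "U \<subseteq> V"
    "\<And>x u. x \<in> carrier (corner_ring R (e j)) \<Longrightarrow> u \<in> U \<Longrightarrow> x \<otimes> u \<in> U"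
    using U by (simp_all add: V_submodule_iff)
  interpret U: additive_subgroup U R by (rule U'(1))
  note iff = K_iff[OF U'(1,2)]
  note c = idem(1)[OF i] idem(1)[OF j]
  have KD: "x \<in> rad_pow R (n - 1)" "x \<in> carrier R" "x \<otimes> e i = x" "e j \<otimes> x \<in> U" if "x \<in> K U" for x
    using that iff T.Icarr by blast+
  have "additive_subgroup (K U) R"
  proof (rule additive_subgroupI, rule add.subgroupI)
    show "K U \<subseteq> carrier R" using KD by blast
    have "\<zero> \<in> K U" unfolding iff using c T.zero_closed U.zero_closed by simp
    then show "K U \<noteq> {}" by blast
    show "\<ominus> x \<in> K U" if "x \<in> K U" for x
      unfolding iff using KD[OF that] c T.a_inv_closed[OF KD(1)[OF that]]
      by (simp add: l_minus r_minus)
    show "x \<oplus> y \<in> K U" if "x \<in> K U" "y \<in> K U" for x y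
      unfolding iff using KD[OF that(1)] KD[OF that(2)] c T.a_closed[OF KD(1)[OF that(1)] KD(1)[OF that(2)]]
      by (simp add: l_distr r_distr)
  qed
  moreover have "K U \<subseteq> P" using KD P_iff by blast
  moreover have "a \<otimes> x \<in> K U" if a: "a \<in> carrier R" and x: "x \<in> K U" for a x
  proof -
    have "e j \<otimes> a \<otimes> e j \<in> carrier (corner_ring R (e j))"
      unfolding corner_carrier_iff[OF idem(1,2)[OF j]]
    proof (intro conjI)
      show "e j \<otimes> (e j \<otimes> a \<otimes> e j) = e j \<otimes> a \<otimes> e j" using a idem[OF j] by (simp add: m_assoc[symmetric])
      show "e j \<otimes> a \<otimes> e j \<otimes> e j = e j \<otimes> a \<otimes> e j" using a idem[OF j] by (simp add: m_assoc)
    qed (use a c in simp)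
    then have "e j \<otimes> (a \<otimes> x) \<in> U"
      unfolding component_of_mult[OF KD(1)[OF x] a] using KD(4)[OF x] by (rule U'(3))
    moreover have "a \<otimes> x \<in> rad_pow R (n - 1)" using KD(1)[OF x] a by (rule T.I_l_closed)
    moreover have "a \<otimes> x \<otimes> e i = a \<otimes> x" using a KD[OF x] c by (simp add: m_assoc)
    ultimately show ?thesis unfolding iff by blast
  qed
  moreover have "proj R (e i) = mk_module P (add R) \<zero> (monoid.mult R)"
    by (simp add: proj_def left_ideal_module_def)
  ultimately show ?thesis
    using mk_module_submodule_iff[OF P_subgroup, of "K U" R "monoid.mult R"] by simp
qed

section \<open>Isomorphisms between the modules \<open>M\<^sub>U\<close>\<close>

text \<open>Right multiplication by a unit \<open>x\<close> of \<open>e\<^sub>i R e\<^sub>i\<close> is an automorphism of \<open>P\<^sub>i\<close>; since it commutes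
  with \<open>e\<^sub>j\<close> acting from the left, it carries \<open>K\<^sub>U\<close> to \<open>K\<^bsub>U x\<^esub>\<close>.\<close>
lemma M_iso_of_unit:
  assumes U: "U \<in> top_Gr R n s (e j) (e i)"
    and x: "x \<in> corner" "y \<in> corner" "x \<otimes> y = e i" "y \<otimes> x = e i"
  shows "module_iso R (M_quot R n t e i j U) (M_quot R n t e i j ((\<lambda>u. u \<otimes> x) ` U))"
proof -
  let ?U' = "(\<lambda>u. u \<otimes> x) ` U"
  have subU: "submodule U D\<^sub>j (top_bimodule R n (e j) (e i))" using U by (simp add: top_Gr_def)
  have subU': "submodule ?U' D\<^sub>j (top_bimodule R n (e j) (e i))"
    using Gr_translate_closed[OF U x] by (simp add: top_Gr_def)
  have gU: "additive_subgroup U R" "U \<subseteq> V" and gU': "additive_subgroup ?U' R" "?U' \<subseteq> V"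
    using subU subU' unfolding V_submodule_iff by blast+
  have xR: "x \<in> carrier R" "x \<otimes> e i = x" and yR: "y \<in> carrier R" "y \<otimes> e i = y"
    using x corner_iff by blast+
  have inv: "z \<otimes> x \<otimes> y = z" "z \<otimes> y \<otimes> x = z" if "z \<in> P" for z
    using that xR yR x(3,4) by (simp_all add: P_iff m_assoc)
  have Px: "z \<otimes> x \<in> P" "z \<otimes> y \<in> P" if "z \<in> P" for z
    using that xR yR idem(1)[OF i] by (simp_all add: P_iff m_assoc)
  interpret PO: operator_group R "proj R (e i)" by (rule proj_operator_group)
  have ops: "a \<oplus>\<^bsub>proj R (e i)\<^esub> b = a \<oplus> b" "a \<odot>\<^bsub>proj R (e i)\<^esub> b = a \<otimes> b" for a b
    by (simp_all add: proj_def)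
  show ?thesis
    unfolding M_quot_def
  proof (rule PO.quot_module_iso_of_automorphism[where f = "\<lambda>z. z \<otimes> x"])
    show "submodule (K U) R (proj R (e i))" by (rule K_submodule[OF subU])
    show "submodule (K ?U') R (proj R (e i))" by (rule K_submodule[OF subU'])
    show "(\<lambda>z. z \<otimes> x) ` P = P"
    proof
      show "(\<lambda>z. z \<otimes> x) ` P \<subseteq> P" using Px by blast
      show "P \<subseteq> (\<lambda>z. z \<otimes> x) ` P"
      proof
        fix z assume z: "z \<in> P"
        then have "z = (z \<otimes> y) \<otimes> x" using inv by simp
        then show "z \<in> (\<lambda>z. z \<otimes> x) ` P" using Px(2)[OF z] by blast
      qed
    qed
    show "(a \<oplus>\<^bsub>proj R (e i)\<^esub> b) \<otimes> x = a \<otimes> x \<oplus>\<^bsub>proj R (e i)\<^esub> b \<otimes> x" if "a \<in> P" "b \<in> P" for a b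
      using that xR by (simp add: ops P_iff l_distr)
    show "(r \<odot>\<^bsub>proj R (e i)\<^esub> a) \<otimes> x = r \<odot>\<^bsub>proj R (e i)\<^esub> (a \<otimes> x)"
      if "r \<in> carrier R" "a \<in> P" for r a
      using that xR by (simp add: ops P_iff m_assoc)
    show "z \<otimes> x \<in> K ?U' \<longleftrightarrow> z \<in> K U" if z: "z \<in> P" for z
    proof
      have zR: "z \<in> carrier R" using z by (simp add: P_iff)
      note ej = idem(1)[OF j]
      show "z \<in> K U" if "z \<otimes> x \<in> K ?U'"
      proof -
        have zx: "z \<otimes> x \<in> rad_pow R (n - 1)" "e j \<otimes> (z \<otimes> x) \<in> ?U'"
          using that unfolding K_iff[OF gU'] by blast+
        have "z \<otimes> x \<otimes> y \<in> rad_pow R (n - 1)" using zx(1) yR(1) by (rule T.I_r_closed)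
        then have zT: "z \<in> rad_pow R (n - 1)" unfolding inv(1)[OF z] .
        obtain u where u: "u \<in> U" "e j \<otimes> (z \<otimes> x) = u \<otimes> x" using zx(2) by blast
        have "u \<in> P" using u(1) gU(2) V_iff V_carrier P_iff by blast
        then have "u = u \<otimes> x \<otimes> y" using inv by simp
        also have "\<dots> = e j \<otimes> (z \<otimes> x \<otimes> y)"
          unfolding u(2)[symmetric] using ej zR xR(1) yR(1) by (simp add: m_assoc)
        also have "\<dots> = e j \<otimes> z" unfolding inv(1)[OF z] ..
        finally have "e j \<otimes> z \<in> U" using u(1) by simp
        then show ?thesis unfolding K_iff[OF gU] using zT z P_iff by blast
      qed
      show "z \<otimes> x \<in> K ?U'" if "z \<in> K U"
      proof -
        have z': "z \<in> rad_pow R (n - 1)" "e j \<otimes> z \<in> U" using that unfolding K_iff[OF gU] by blast+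
        have "z \<otimes> x \<in> rad_pow R (n - 1)" using z'(1) xR(1) by (rule T.I_r_closed)
        moreover have "z \<otimes> x \<otimes> e i = z \<otimes> x" using zR xR idem(1)[OF i] by (simp add: m_assoc)
        moreover have "e j \<otimes> (z \<otimes> x) = (e j \<otimes> z) \<otimes> x" using ej zR xR(1) by (simp add: m_assoc)
        ultimately show ?thesis unfolding K_iff[OF gU'] using z'(2) by blast
      qed
    qed
  qed
qed

text \<open>An isomorphism sends the generator \<open>e\<^sub>i + K\<^sub>U\<close> to some \<open>x + K\<^bsub>U'\<^esub>\<close> with \<open>x \<in> e\<^sub>i R e\<^sub>i\<close>, so
  it is induced by right multiplication by \<open>x\<close>.\<close>
lemma M_iso_lift:
  assumes U: "submodule U D\<^sub>j (top_bimodule R n (e j) (e i))"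
    and U': "submodule U' D\<^sub>j (top_bimodule R n (e j) (e i))"
    and iso: "module_iso R (M_quot R n t e i j U) (M_quot R n t e i j U')"
  obtains x w where "x \<in> corner" "\<And>z. z \<in> P \<Longrightarrow> z \<otimes> x \<in> K U' \<longleftrightarrow> z \<in> K U"
    "w \<in> P" "w \<otimes> x \<oplus> \<ominus> e i \<in> K U'"
proof -
  interpret PO: operator_group R "proj R (e i)" by (rule proj_operator_group)
  note N = K_submodule[OF U] and N' = K_submodule[OF U']
  have proj_mk: "proj R (e i) = mk_module P (add R) \<zero> (monoid.mult R)"
    by (simp add: proj_def left_ideal_module_def)
  have ops: "a \<oplus>\<^bsub>proj R (e i)\<^esub> b = a \<oplus> b" "a \<odot>\<^bsub>proj R (e i)\<^esub> b = a \<otimes> b" for a b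
    by (simp_all add: proj_def)
  have minus: "\<ominus>\<^bsub>proj R (e i)\<^esub> b = \<ominus> b" if "b \<in> P" for b
    using mk_module_a_inv[OF P_subgroup that] proj_mk by metis
  define q where "q = (\<lambda>z. K U +>\<^bsub>proj R (e i)\<^esub> z)"
  define q' where "q' = (\<lambda>z. K U' +>\<^bsub>proj R (e i)\<^esub> z)"
  have q_eq: "q a = q b \<longleftrightarrow> a \<oplus> \<ominus> b \<in> K U" "q' a = q' b \<longleftrightarrow> a \<oplus> \<ominus> b \<in> K U'" if "a \<in> P" "b \<in> P" for a b
    unfolding q_def q'_def
    using PO.coset_eq_iff[OF N that] PO.coset_eq_iff[OF N' that] minus[OF that(2)] by (simp_all add: ops)
  obtain f where f: "bij_betw f (carrier (M_quot R n t e i j U)) (carrier (M_quot R n t e i j U'))"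
    "\<And>r c. r \<in> carrier R \<Longrightarrow> c \<in> carrier (M_quot R n t e i j U) \<Longrightarrow>
      f (r \<odot>\<^bsub>M_quot R n t e i j U\<^esub> c) = r \<odot>\<^bsub>M_quot R n t e i j U'\<^esub> f c"
    using iso by (rule module_isoE) blast
  have eP: "e i \<in> P" "\<zero> \<in> P" unfolding P_iff using idem[OF i] by simp_all
  have qc: "q z \<in> carrier (M_quot R n t e i j U)" "q' z \<in> carrier (M_quot R n t e i j U')" if "z \<in> P" for z
    unfolding q_def q'_def M_quot_def using PO.quot_carrierI[OF that] by blast+
  have "f (q (e i)) \<in> carrier (M_quot R n t e i j U')" using f(1) qc(1)[OF eP(1)] by (rule bij_betw_apply)
  then obtain y where y: "y \<in> P" "f (q (e i)) = q' y"
    unfolding M_quot_def q'_def by (rule PO.quot_carrierE)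
  define x where "x = e i \<otimes> y"
  have y': "y \<in> carrier R" "y \<otimes> e i = y" using y(1) by (simp_all add: P_iff)
  have x: "x \<in> corner"
    unfolding corner_iff x_def using y' idem[OF i] by (simp add: m_assoc) (simp add: m_assoc[symmetric])
  have xR: "x \<in> carrier R" "x \<otimes> e i = x" using x corner_iff by blast+
  have Px: "z \<otimes> x \<in> P" if "z \<in> P" for z using that xR idem(1)[OF i] by (simp add: P_iff m_assoc)
  have fq: "f (q z) = q' (z \<otimes> x)" if z: "z \<in> P" for z
  proof -
    have zR: "z \<in> carrier R" "z \<otimes> e i = z" using z by (simp_all add: P_iff)
    have "z \<odot>\<^bsub>M_quot R n t e i j U\<^esub> q (e i) = q z"
      unfolding q_def M_quot_def PO.quot_smult[OF N zR(1) eP(1)] by (simp add: ops zR)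
    then have "f (q z) = z \<odot>\<^bsub>M_quot R n t e i j U'\<^esub> q' y"
      using f(2)[OF zR(1) qc(1)[OF eP(1)]] y(2) by simp
    also have "\<dots> = q' (z \<otimes> y)"
      unfolding q'_def M_quot_def PO.quot_smult[OF N' zR(1) y(1)] by (simp add: ops)
    also have "z \<otimes> y = z \<otimes> x"
      unfolding x_def using zR y'(1) idem(1)[OF i] by (simp add: m_assoc[symmetric])
    finally show ?thesis .
  qed
  have "z \<otimes> x \<in> K U' \<longleftrightarrow> z \<in> K U" if z: "z \<in> P" for z
  proof -
    have zR: "z \<in> carrier R" using z by (simp add: P_iff)
    have "z \<in> K U \<longleftrightarrow> q z = q \<zero>" using q_eq(1)[OF z eP(2)] zR by simp
    also have "\<dots> \<longleftrightarrow> f (q z) = f (q \<zero>)"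
      using inj_on_eq_iff[OF bij_betw_imp_inj_on[OF f(1)] qc(1)[OF z] qc(1)[OF eP(2)]] by simp
    also have "\<dots> \<longleftrightarrow> q' (z \<otimes> x) = q' \<zero>" unfolding fq[OF z] fq[OF eP(2)] using xR by simp
    also have "\<dots> \<longleftrightarrow> z \<otimes> x \<in> K U'" using q_eq(2)[OF Px[OF z] eP(2)] zR xR(1) by simp
    finally show ?thesis by simp
  qed
  moreover obtain w where "w \<in> P" "w \<otimes> x \<oplus> \<ominus> e i \<in> K U'"
  proof -
    have "q' (e i) \<in> f ` carrier (M_quot R n t e i j U)"
      using qc(2)[OF eP(1)] bij_betw_imp_surj_on[OF f(1)] by simp
    then obtain c where c: "c \<in> carrier (M_quot R n t e i j U)" "q' (e i) = f c" by blast
    obtain w where w: "w \<in> P" "c = q w" using c(1) unfolding M_quot_def q_def by (rule PO.quot_carrierE)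
    have "q' (w \<otimes> x) = q' (e i)" using c(2) w fq by simp
    then show thesis using that w(1) q_eq(2)[OF Px[OF w(1)] eP(1)] by blast
  qed
  ultimately show thesis using that x by blast
qed

text \<open>Let \<open>x\<close> induce the isomorphism, and let \<open>w + K\<^sub>U\<close> be the preimage of \<open>e\<^sub>i + K\<^bsub>U'\<^esub>\<close>.  If \<open>x\<close> were
  radical, then \<open>e\<^sub>i w x - e\<^sub>i\<close> would be a unit
  of the local ring \<open>e\<^sub>i R e\<^sub>i\<close> lying in \<open>K\<^bsub>U'\<^esub>\<close>.  Thus \<open>e\<^sub>i \<in> K\<^bsub>U'\<^esub>\<close> and \<open>U' = V\<close>, which positive
  codimension excludes.\<close>
lemma unit_of_M_iso:
  assumes U: "U \<in> top_Gr R n s (e j) (e i)" and U': "U' \<in> top_Gr R n s (e j) (e i)" and s: "s \<ge> 1"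
    and iso: "module_iso R (M_quot R n t e i j U) (M_quot R n t e i j U')"
  obtains x y where "x \<in> corner" "y \<in> corner" "x \<otimes> y = e i" "y \<otimes> x = e i" "U' = (\<lambda>u. u \<otimes> x) ` U"
proof -
  have subU: "submodule U D\<^sub>j (top_bimodule R n (e j) (e i))"
    and subU': "submodule U' D\<^sub>j (top_bimodule R n (e j) (e i))"
    using U U' by (simp_all add: top_Gr_def)
  have gU: "additive_subgroup U R" "U \<subseteq> V" and gU': "additive_subgroup U' R" "U' \<subseteq> V"
    using subU subU' unfolding V_submodule_iff by blast+
  have K_mult: "a \<otimes> z \<in> K U'" if "a \<in> carrier R" "z \<in> K U'" for a z
    using submodule.smult_closed[OF K_submodule[OF subU'] that] by (simp add: proj_def)
  obtain x w where x: "x \<in> corner" and x_iff: "\<And>z. z \<in> P \<Longrightarrow> z \<otimes> x \<in> K U' \<longleftrightarrow> z \<in> K U"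
    and w: "w \<in> P" "w \<otimes> x \<oplus> \<ominus> e i \<in> K U'"
    by (rule M_iso_lift[OF subU subU' iso]) blast
  note ei = idem[OF i]
  have xR: "x \<in> carrier R" "x \<otimes> e i = x" "e i \<otimes> x = x" using x corner_iff by blast+
  have wR: "w \<in> carrier R" using w(1) P_iff by blast
  have "x \<notin> jacobson_radical R"
  proof
    assume xJ: "x \<in> jacobson_radical R"
    \<comment> \<open>Multiplying \<open>w x - e\<^sub>i \<in> K\<^bsub>U'\<^esub>\<close> by \<open>e\<^sub>i\<close> from the left moves it into the corner.\<close>
    define c where "c = e i \<otimes> w \<otimes> x"
    have cJ: "c \<in> jacobson_radical R" unfolding c_def using xJ ei(1) wR by (intro J.I_l_closed) auto
    have c: "c \<in> corner"
      unfolding corner_iff c_def using ei xR wR by (simp add: m_assoc) (simp add: m_assoc[symmetric])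
    have one: "e i \<in> corner" unfolding corner_iff using ei by simp
    have cR: "c \<in> carrier R" using c corner_iff by blast
    define d where "d = c \<oplus> \<ominus> e i"
    have d: "d \<in> corner" unfolding d_def by (rule corner_minus_closed[OF ei(1,2) c one])
    have "e i \<otimes> (w \<otimes> x \<oplus> \<ominus> e i) = d"
      unfolding d_def c_def using ei wR xR by (simp add: r_distr r_minus m_assoc)
    then have dK: "d \<in> K U'" using K_mult[OF ei(1) w(2)] by simp
    have "d \<notin> jacobson_radical R"
    proof
      assume "d \<in> jacobson_radical R"
      then have "c \<oplus> \<ominus> d \<in> jacobson_radical R" using cJ by blast
      moreover have "c \<oplus> \<ominus> d = e i"
        unfolding d_def using cR ei(1) by (simp add: minus_add a_assoc[symmetric] r_neg)
      ultimately show False using idempotent_notin_radical[OF ei] by simp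
    qed
    then obtain b where b: "b \<in> corner" "b \<otimes> d = e i" using corner_local[OF i d] by blast
    then have eK: "e i \<in> K U'" using K_mult[OF _ dK, of b] corner_iff by metis
    have "V \<subseteq> U'"
    proof
      fix v assume v: "v \<in> V"
      have "v \<otimes> e i \<in> K U'" using K_mult[OF V_carrier[OF v] eK] .
      then have "v \<in> K U'" using v V_iff by simp
      then show "v \<in> U'" using K_iff[OF gU', of v] V_iff v by simp
    qed
    then show False using Gr_proper[OF U' s] gU'(2) by blast
  qed
  then obtain y where y: "y \<in> corner" "x \<otimes> y = e i" "y \<otimes> x = e i" using corner_local[OF i x] by blast
  have yR: "y \<in> carrier R" "y \<otimes> e i = y" using y(1) corner_iff by blast+
  have VK: "v \<in> K U \<longleftrightarrow> v \<in> U" "v \<in> K U' \<longleftrightarrow> v \<in> U'" "v \<in> P" if "v \<in> V" for v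
    using that V_iff[of v] V_carrier[OF that] by (simp_all add: K_iff[OF gU] K_iff[OF gU'] P_iff)
  have "U' = (\<lambda>u. u \<otimes> x) ` U"
  proof
    show "(\<lambda>u. u \<otimes> x) ` U \<subseteq> U'"
    proof
      fix v assume "v \<in> (\<lambda>u. u \<otimes> x) ` U"
      then obtain u where u: "u \<in> U" "v = u \<otimes> x" by blast
      have uV: "u \<in> V" using u(1) gU(2) by blast
      show "v \<in> U'"
        using x_iff[OF VK(3)[OF uV]] VK(1)[OF uV] u VK(2)[OF V_rmult_closed[OF x uV]] by simp
    qed
    show "U' \<subseteq> (\<lambda>u. u \<otimes> x) ` U"
    proof
      fix v assume v: "v \<in> U'"
      have vV: "v \<in> V" using v gU'(2) by blast
      have eq: "v \<otimes> y \<otimes> x = v" using V_carrier[OF vV] xR yR y(3) V_iff vV by (simp add: m_assoc)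
      have vyV: "v \<otimes> y \<in> V" by (rule V_rmult_closed[OF y(1) vV])
      have "v \<otimes> y \<in> U"
        using x_iff[OF VK(3)[OF vyV]] VK(1)[OF vyV] VK(2)[OF vV] v eq by simp
      then show "v \<in> (\<lambda>u. u \<otimes> x) ` U" using eq by force
    qed
  qed
  then show thesis using that x y by blast
qed

lemma M_iso_iff:
  assumes U: "U \<in> top_Gr R n s (e j) (e i)" and U': "U' \<in> top_Gr R n s (e j) (e i)" and s: "s \<ge> 1"
  shows "module_iso R (M_quot R n t e i j U) (M_quot R n t e i j U') \<longleftrightarrow>
    (\<exists>a\<in>Units D\<^sub>i. U' = right_translate R U a)"
proof
  have UV: "U \<subseteq> V" using U unfolding top_Gr_def V_submodule_iff by blast
  assume "module_iso R (M_quot R n t e i j U) (M_quot R n t e i j U')"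
  then obtain x y where xy: "x \<in> corner" "y \<in> corner" "x \<otimes> y = e i" "y \<otimes> x = e i"
    and "U' = (\<lambda>u. u \<otimes> x) ` U"
    by (rule unit_of_M_iso[OF U U' s])
  then have "U' = right_translate R U (residue (e i) x)"
    using right_translate_residue[OF xy(1) UV] by simp
  then show "\<exists>a\<in>Units D\<^sub>i. U' = right_translate R U a" using residue_unitI[OF i xy] by blast
next
  have UV: "U \<subseteq> V" using U unfolding top_Gr_def V_submodule_iff by blast
  assume "\<exists>a\<in>Units D\<^sub>i. U' = right_translate R U a"
  then obtain a where a: "a \<in> Units D\<^sub>i" "U' = right_translate R U a" by blast
  obtain x y where xy: "x \<in> corner" "y \<in> corner" "x \<otimes> y = e i" "y \<otimes> x = e i" "a = residue (e i) x"
    by (rule residue_unit_lift[OF i a(1)])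
  show "module_iso R (M_quot R n t e i j U) (M_quot R n t e i j U')"
    using M_iso_of_unit[OF U xy(1-4)] right_translate_residue[OF xy(1) UV] a(2) xy(5) by simp
qed

lemma Gr_right_group_action:
  "right_group_action (units_of D\<^sub>i) (top_Gr R n s (e j) (e i)) (right_translate R)"
proof -
  interpret D: ring D\<^sub>i by (rule division_alg_ring[OF idem(1,2)[OF i]])
  have UV: "U \<subseteq> V" if "U \<in> top_Gr R n s (e j) (e i)" for U
    using that unfolding top_Gr_def V_submodule_iff by blast
  show ?thesis
    unfolding right_group_action_def units_of_carrier units_of_one units_of_mult
  proof (intro conjI ballI)
    show "group (units_of D\<^sub>i)" by (rule D.units_group)
  next
    fix U a assume U: "U \<in> top_Gr R n s (e j) (e i)" and a: "a \<in> Units D\<^sub>i"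
    obtain x y where xy: "x \<in> corner" "y \<in> corner" "x \<otimes> y = e i" "y \<otimes> x = e i" "a = residue (e i) x"
      by (rule residue_unit_lift[OF i a])
    show "right_translate R U a \<in> top_Gr R n s (e j) (e i)"
      unfolding xy(5) right_translate_residue[OF xy(1) UV[OF U]] by (rule Gr_translate_closed[OF U xy(1-4)])
  next
    fix U assume U: "U \<in> top_Gr R n s (e j) (e i)"
    have one: "e i \<in> corner" unfolding corner_iff using idem[OF i] by simp
    have "(\<lambda>u. u \<otimes> e i) ` U = (\<lambda>u. u) ` U" using UV[OF U] V_iff by (intro image_cong refl) blast
    then show "right_translate R U \<one>\<^bsub>D\<^sub>i\<^esub> = U"
      unfolding division_alg_one right_translate_residue[OF one UV[OF U]] by simp
  next
    fix U a b assume U: "U \<in> top_Gr R n s (e j) (e i)" and a: "a \<in> Units D\<^sub>i" and b: "b \<in> Units D\<^sub>i"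
    obtain x where x: "x \<in> corner" "a = residue (e i) x" by (rule residue_unit_lift[OF i a]) blast
    obtain z where z: "z \<in> corner" "b = residue (e i) z" by (rule residue_unit_lift[OF i b]) blast
    interpret C: ring "corner_ring R (e i)" by (rule corner_ring_is_ring[OF idem(1,2)[OF i]])
    have xz: "x \<otimes> z \<in> corner" using C.m_closed[OF x(1) z(1)] by (simp add: corner_ring_simps)
    have "right_translate R U (a \<otimes>\<^bsub>D\<^sub>i\<^esub> b) = (\<lambda>u. u \<otimes> (x \<otimes> z)) ` U"
      unfolding x(2) z(2) division_alg_mult[OF idem(1,2)[OF i] x(1) z(1)]
      by (rule right_translate_residue[OF xz UV[OF U]])
    also have "\<dots> = (\<lambda>u. u \<otimes> x \<otimes> z) ` U"
      using UV[OF U] V_carrier x(1) z(1) corner_iff by (intro image_cong refl m_assoc[symmetric]) blast+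
    also have "\<dots> = (\<lambda>u. u \<otimes> z) ` right_translate R U a"
      unfolding x(2) right_translate_residue[OF x(1) UV[OF U]] image_image ..
    also have "\<dots> = right_translate R (right_translate R U a) b"
    proof -
      have "right_translate R U a \<subseteq> V"
        unfolding x(2) right_translate_residue[OF x(1) UV[OF U]]
        using V_rmult_closed[OF x(1)] UV[OF U] by blast
      then show ?thesis unfolding z(2) using right_translate_residue[OF z(1)] by simp
    qed
    finally show "right_translate R U (a \<otimes>\<^bsub>D\<^sub>i\<^esub> b) = right_translate R (right_translate R U a) b" .
  qed
qed

text \<open>The bijection sends a class \<open>c\<close> of modules to \<open>{U. M\<^sub>U \<in> c}\<close>; the class is recovered as the
  set of the \<open>M\<^sub>U\<close>.\<close>
lemma fibre_orbits_bijection: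
  assumes s: "s \<ge> 1"
  shows "\<exists>\<Phi>. bij_betw \<Phi> (terminal_fibre R n t e i j s)
      (orbits (units_of D\<^sub>i) (top_Gr R n s (e j) (e i)) (\<lambda>a U. right_translate R U a))
    \<and> (\<forall>U \<in> top_Gr R n s (e j) (e i).
      \<Phi> (iso_class R n t e i j s U) = orbit (units_of D\<^sub>i) (\<lambda>a U. right_translate R U a) U)"
proof -
  let ?G = "top_Gr R n s (e j) (e i)" and ?M = "M_quot R n t e i j" and ?cl = "iso_class R n t e i j s"
  let ?orb = "orbit (units_of D\<^sub>i) (\<lambda>a U. right_translate R U a)"
  define \<Phi> where "\<Phi> = (\<lambda>c. {U \<in> ?G. ?M U \<in> c})"
  have cl: "?cl U = {N \<in> ?M ` ?G. module_iso R (?M U) N}" if "U \<in> ?G" for U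
    using that by (auto simp: iso_class_def module_iso_rel_def fibre_modules_def)
  have fibre: "terminal_fibre R n t e i j s = ?cl ` ?G"
    unfolding terminal_fibre_def quotient_def iso_class_def fibre_modules_def by blast
  have \<Phi>_cl: "\<Phi> (?cl U) = ?orb U" if U: "U \<in> ?G" for U
  proof -
    have closed: "right_translate R U a \<in> ?G" if "a \<in> Units D\<^sub>i" for a
      using Gr_right_group_action[of s] U that
      unfolding right_group_action_def units_of_carrier by (elim conjE) (drule bspec, assumption)+
    have "\<Phi> (?cl U) = {U' \<in> ?G. module_iso R (?M U) (?M U')}"
      unfolding \<Phi>_def cl[OF U] by blast
    also have "\<dots> = {U' \<in> ?G. \<exists>a\<in>Units D\<^sub>i. U' = right_translate R U a}"
      using M_iso_iff[OF U _ s] by blast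
    also have "\<dots> = ?orb U"
      unfolding orbit_def units_of_carrier using closed by blast
    finally show ?thesis .
  qed
  have "inj_on \<Phi> (?cl ` ?G)"
  proof (rule inj_on_inverseI)
    fix c assume "c \<in> ?cl ` ?G"
    then obtain U where "U \<in> ?G" "c = ?cl U" by blast
    then show "?M ` \<Phi> c = c" using cl unfolding \<Phi>_def by auto
  qed
  moreover have "\<Phi> ` (?cl ` ?G) = orbits (units_of D\<^sub>i) ?G (\<lambda>a U. right_translate R U a)"
  proof -
    have "\<Phi> ` (?cl ` ?G) = ?orb ` ?G" unfolding image_image using \<Phi>_cl by (rule image_cong[OF refl])
    then show ?thesis unfolding orbits_def by blast
  qed
  ultimately have "bij_betw \<Phi> (terminal_fibre R n t e i j s)
      (orbits (units_of D\<^sub>i) ?G (\<lambda>a U. right_translate R U a))"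
    unfolding fibre bij_betw_def by blast
  then show ?thesis using \<Phi>_cl by blast
qed

end

section \<open>Basic algebras\<close>

text \<open>A non-radical element of \<open>e\<^sub>h A e\<^bsub>h'\<^esub>\<close> would be invertible, and right multiplication by it
  would identify \<open>A e\<^sub>h\<close> with \<open>A e\<^bsub>h'\<^esub>\<close>.\<close>
lemma (in fin_dim_algebra) basic_off_diagonal:
  assumes idem: "complete_primitive_idempotents A t e" and "basic A t e"
    and h: "h \<in> {1..t}" "h' \<in> {1..t}" "h \<noteq> h'"
    and x: "x \<in> carrier A" "e h \<otimes>\<^bsub>A\<^esub> x = x" "x \<otimes>\<^bsub>A\<^esub> e h' = x"
  shows "x \<in> jacobson_radical A"
proof (rule ccontr)
  assume notin: "x \<notin> jacobson_radical A"
  have prim: "primitive_idempotent A (e h)" "primitive_idempotent A (e h')"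
    using idem h by (simp_all add: complete_primitive_idempotents_def)
  obtain y where y: "y \<in> carrier A" "e h' \<otimes>\<^bsub>A\<^esub> y = y" "y \<otimes>\<^bsub>A\<^esub> e h = y"
    "x \<otimes>\<^bsub>A\<^esub> y = e h" "y \<otimes>\<^bsub>A\<^esub> x = e h'"
    by (rule off_radical_invertible[OF prim x notin])
  note p = A.primitive_idempotentD[OF prim(1)] and q = A.primitive_idempotentD[OF prim(2)]
  have proj_iff: "z \<in> carrier (proj A f) \<longleftrightarrow> z \<in> carrier A \<and> z \<otimes>\<^bsub>A\<^esub> f = z"
    if "f \<in> carrier A" "f \<otimes>\<^bsub>A\<^esub> f = f" for z f
  proof
    assume "z \<in> carrier (proj A f)"
    then obtain a where "a \<in> carrier A" "z = a \<otimes>\<^bsub>A\<^esub> f" by (auto simp: proj_def)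
    then show "z \<in> carrier A \<and> z \<otimes>\<^bsub>A\<^esub> f = z" using that by (simp add: A.m_assoc)
  next
    assume z: "z \<in> carrier A \<and> z \<otimes>\<^bsub>A\<^esub> f = z"
    then have "z = z \<otimes>\<^bsub>A\<^esub> f" by simp
    then show "z \<in> carrier (proj A f)" using z unfolding proj_def left_ideal_module_simps by blast
  qed
  have "module_iso A (proj A (e h)) (proj A (e h'))"
  proof (rule module_isoI[where f = "\<lambda>z. z \<otimes>\<^bsub>A\<^esub> x"])
    show "bij_betw (\<lambda>z. z \<otimes>\<^bsub>A\<^esub> x) (carrier (proj A (e h))) (carrier (proj A (e h')))"
    proof (rule bij_betw_byWitness[where f' = "\<lambda>z. z \<otimes>\<^bsub>A\<^esub> y"])
      show "\<forall>z\<in>carrier (proj A (e h)). z \<otimes>\<^bsub>A\<^esub> x \<otimes>\<^bsub>A\<^esub> y = z"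
        using x(1) y(1,4) by (simp add: proj_iff[OF p(1,2)] A.m_assoc)
      show "\<forall>z\<in>carrier (proj A (e h')). z \<otimes>\<^bsub>A\<^esub> y \<otimes>\<^bsub>A\<^esub> x = z"
        using x(1) y(1,5) by (simp add: proj_iff[OF q(1,2)] A.m_assoc)
      show "(\<lambda>z. z \<otimes>\<^bsub>A\<^esub> x) ` carrier (proj A (e h)) \<subseteq> carrier (proj A (e h'))"
        using x q(1) by (auto simp: proj_iff[OF q(1,2)] proj_iff[OF p(1,2)] A.m_assoc)
      show "(\<lambda>z. z \<otimes>\<^bsub>A\<^esub> y) ` carrier (proj A (e h')) \<subseteq> carrier (proj A (e h))"
        using y p(1) by (auto simp: proj_iff[OF q(1,2)] proj_iff[OF p(1,2)] A.m_assoc)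
    qed
  qed (use x(1) in \<open>simp_all add: proj_iff[OF p(1,2)], simp_all add: proj_def A.l_distr A.m_assoc\<close>)
  then show False using assms(2) h unfolding basic_def by blast
qed

lemma (in fin_dim_algebra) basic_ring_of_basic_algebra:
  assumes "n \<ge> 1" "rad_pow A n = {\<zero>\<^bsub>A\<^esub>}"
    and idem: "complete_primitive_idempotents A t e" and basic: "basic A t e"
  shows "basic_ring A n t e"
proof (intro basic_ring.intro A.ring_axioms basic_ring_axioms.intro assms(1-3))
  fix h h' x
  assume "h \<in> {1..t}" "h' \<in> {1..t}" "h \<noteq> h'" "x \<in> carrier A" "e h \<otimes>\<^bsub>A\<^esub> x = x" "x \<otimes>\<^bsub>A\<^esub> e h' = x"
  then show "x \<in> jacobson_radical A" by (rule basic_off_diagonal[OF idem basic])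
next
  fix h x assume h: "h \<in> {1..t}" and x: "x \<in> carrier (corner_ring A (e h))" "x \<notin> jacobson_radical A"
  have prim: "primitive_idempotent A (e h)"
    using idem h by (simp add: complete_primitive_idempotents_def)
  note iff = A.corner_carrier_iff[OF A.primitive_idempotentD(1,2)[OF prim]]
  have x': "x \<in> carrier A" "e h \<otimes>\<^bsub>A\<^esub> x = x" "x \<otimes>\<^bsub>A\<^esub> e h = x" using x(1) by (simp_all add: iff)
  obtain y where "y \<in> carrier A" "e h \<otimes>\<^bsub>A\<^esub> y = y" "y \<otimes>\<^bsub>A\<^esub> e h = y"
    "x \<otimes>\<^bsub>A\<^esub> y = e h" "y \<otimes>\<^bsub>A\<^esub> x = e h"
    by (rule off_radical_invertible[OF prim prim x' x(2)])
  then show "\<exists>y\<in>carrier (corner_ring A (e h)). x \<otimes>\<^bsub>A\<^esub> y = e h \<and> y \<otimes>\<^bsub>A\<^esub> x = e h"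
    using iff by blast
qed

theorem theorem6p3:
  fixes K :: "('k, 'c) ring_scheme" and A :: "('k, 'a, 'm) module_scheme"
    and n t i j s :: nat and e :: "nat \<Rightarrow> 'a"
  assumes "fin_dim_algebra K A"
    and "n \<ge> 1"
    and "rad_pow A n = {\<zero>\<^bsub>A\<^esub>}"
    and "complete_primitive_idempotents A t e"
    and "basic A t e"
    and "i \<in> {1..t}" and "j \<in> {1..t}"
    and "carrier (top_bimodule A n (e j) (e i)) \<noteq> {\<zero>\<^bsub>A\<^esub>}"
    and "1 \<le> s" and "s \<le> top_dim A n (e j) (e i)"
  shows "right_group_action (units_of (division_alg A (e i))) (top_Gr A n s (e j) (e i))
           (right_translate A)
    \<and> (\<exists>\<Phi>. bij_betw \<Phi> (terminal_fibre A n t e i j s)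
           (orbits (units_of (division_alg A (e i))) (top_Gr A n s (e j) (e i))
              (\<lambda>a U. right_translate A U a))
         \<and> (\<forall>U \<in> top_Gr A n s (e j) (e i).
              \<Phi> (iso_class A n t e i j s U) =
                orbit (units_of (division_alg A (e i))) (\<lambda>a U. right_translate A U a) U))
    \<and> (\<forall>U \<in> top_Gr A n s (e j) (e i). \<forall>U' \<in> top_Gr A n s (e j) (e i).
         module_iso A (M_quot A n t e i j U) (M_quot A n t e i j U') \<longleftrightarrow>
           (\<exists>a \<in> Units (division_alg A (e i)). U' = right_translate A U a))"
proof -
  interpret fin_dim_algebra K A by fact
  interpret B: basic_ring A n t e by (rule basic_ring_of_basic_algebra) fact+
  interpret top_layer A n t e i j by unfold_locales fact+
  show ?thesis
    using Gr_right_group_action[of s] fibre_orbits_bijection[OF assms(9)] M_iso_iff[OF _ _ assms(9)] by blast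
qed

end
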